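(* Consider the adaptive linear model $y_t=\boldsymbol{x}_t^\top\boldsymbol{\theta}^*+\epsilon_t$ described in the context, with $\|\boldsymbol{x}_t\|_2\le 1$ for all $t$ and noise satisfying, for some $\delta>0$, $$\mathbb{E}[\epsilon_t\mid\mathcal{F}_{t-1}]=0,\qquad \mathbb{E}[\epsilon_t^2\mid\mathcal{F}_{t-1}]=\sigma^2,\qquad \sup_{t\ge 1}\mathbb{E}[|\epsilon_t/\sigma|^{2+\delta}\mid\mathcal{F}_{t-1}]<\infty .$$ Let $\mathbf{\Sigma}_0\succeq\mathbf{I}_d$ be an $\mathcal{F}_0$-measurable symmetric $d\times d$ matrix (possibly depending on $n$), and for $t\in[n]$ define $$\mathbf{\Sigma}_t=\mathbf{\Sigma}_0+\sum_{i=1}^t\boldsymbol{x}_i\boldsymbol{x}_i^\top,\quad \boldsymbol{z}_t=\mathbf{\Sigma}_{t-1}^{-1/2}\boldsymbol{x}_t,\quad \mathbf{V}_t=\Big(\mathbf{I}_d+\sum_{i=1}^t\boldsymbol{z}_i\boldsymbol{z}_i^\top\Big)^{-1},\quad \boldsymbol{w}_t=\sqrt{1+\boldsymbol{z}_t^\top\mathbf{V}_{t-1}\boldsymbol{z}_t}\;\mathbf{V}_t\boldsymbol{z}_t,$$ with $\mathbf{V}_0=\mathbf{I}_d$. Suppose $\|\mathbf{\Sigma}_0^{-1}\|_{\mathrm{op}}+\|\mathbf{V}_n\|_{\mathrm{op}}=o_p(1)$ as $n\to\infty$. Let $\widehat{\boldsymbol{\theta}}_{\mathrm{ALEE}}$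 be a solution of $\sum_{t=1}^n\boldsymbol{w}_t(y_t-\boldsymbol{x}_t^\top\widehat{\boldsymbol{\theta}}_{\mathrm{ALEE}})=\mathbf{0}$. Then $$\Big(\sum_{t=1}^n\boldsymbol{w}_t\boldsymbol{x}_t^\top\Big)(\widehat{\boldsymbol{\theta}}_{\mathrm{ALEE}}-\boldsymbol{\theta}^* )\ \overset{d}{\longrightarrow}\ \mathcal{N}(\mathbf{0},\sigma^2\mathbf{I}_d).$$
   Context: Adaptive linear model: the dimension $d$ is fixed, $\boldsymbol{\theta}^*\in\mathbb{R}^d$ is an unknown deterministic parameter, $\sigma>0$, and $y_t=\boldsymbol{x}_t^\top\boldsymbol{\theta}^*+\epsilon_t$ is a scalar response for $t\in[n]$, with covariate $\boldsymbol{x}_t\in\mathbb{R}^d$. There is an increasing sequence of $\sigma$-fields $\{\mathcal{F}_t\}_{t\ge 0}$ such that $\sigma(\boldsymbol{x}_1,y_1,\ldots,\boldsymbol{x}_{t-1},y_{t-1},\boldsymbol{x}_t)\subseteq\mathcal{F}_{t-1}$ for each $t$ (so $\boldsymbol{x}_t$ is $\mathcal{F}_{t-1}$-measurable and $y_t,\epsilon_t$ are $\mathcal{F}_t$-measurable). All asymptotics are as $n\to\infty$; $o_p(1)$ denotes convergence to zero in probability; $\|\cdot\|_{\mathrm{op}}$ is the operator norm; $\succeq$ is the Loewner order; $\mathbf{\Sigma}^{-1/2}$ is the symmetric positive definite inverse square root. *)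

theory Defs
  imports "HOL-Probability.Probability"
begin

section \<open>Matrices\<close>

definition outer_prod :: "real ^ 'm \<Rightarrow> real ^ 'n \<Rightarrow> real ^ 'n ^ 'm" where
  "outer_prod u v = (\<chi> i j. u $ i * v $ j)"

definition pos_semidef :: "real ^ 'd ^ 'd \<Rightarrow> bool" where
  "pos_semidef A \<longleftrightarrow> transpose A = A \<and> (\<forall>v. 0 \<le> v \<bullet> (A *v v))"

definition pos_def :: "real ^ 'd ^ 'd \<Rightarrow> bool" where
  "pos_def A \<longleftrightarrow> transpose A = A \<and> (\<forall>v. v \<noteq> 0 \<longrightarrow> 0 < v \<bullet> (A *v v))"

definition loewner_ge :: "real ^ 'd ^ 'd \<Rightarrow> real ^ 'd ^ 'd \<Rightarrow> bool" where
  "loewner_ge A B \<longleftrightarrow> pos_semidef (A - B)"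

definition op_norm :: "real ^ 'n ^ 'm \<Rightarrow> real" where
  "op_norm A = onorm (\<lambda>v. A *v v)"

text \<open>Meaningful only for positive definite \<open>A\<close>, where the square root exists and is unique.\<close>

definition inv_sqrt_mat :: "real ^ 'd ^ 'd \<Rightarrow> real ^ 'd ^ 'd" where
  "inv_sqrt_mat A = (THE B. pos_def B \<and> B ** B = matrix_inv A)"


section \<open>Probability\<close>

definition tendsto_zero_in_prob :: "'a measure \<Rightarrow> (nat \<Rightarrow> 'a \<Rightarrow> real) \<Rightarrow> bool" where
  "tendsto_zero_in_prob M X \<longleftrightarrow>
     (\<forall>e>0. (\<lambda>n. measure M {\<omega> \<in> space M. \<bar>X n \<omega>\<bar> > e}) \<longlonglongrightarrow> 0)"

text \<open>The library's \<open>weak_conv_m\<close> covers only measures on the real line.\<close>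

definition weakly_converges ::
    "(nat \<Rightarrow> 'b::topological_space measure) \<Rightarrow> 'b measure \<Rightarrow> bool" where
  "weakly_converges \<mu> \<nu> \<longleftrightarrow>
     (\<forall>f :: 'b \<Rightarrow> real. continuous_on UNIV f \<and> bounded (range f) \<longrightarrow>
        (\<lambda>n. \<integral>x. f x \<partial>\<mu> n) \<longlonglongrightarrow> (\<integral>x. f x \<partial>\<nu>))"

definition converges_in_distribution ::
    "'a measure \<Rightarrow> (nat \<Rightarrow> 'a \<Rightarrow> 'b::topological_space) \<Rightarrow> 'b measure \<Rightarrow> bool" where
  "converges_in_distribution M X \<nu> \<longleftrightarrow> weakly_converges (\<lambda>n. distr M borel (X n)) \<nu>"

text \<open>Intended for a positive definite covariance \<open>S\<close>.\<close>

definition multivariate_normal :: "real ^ 'd \<Rightarrow> real ^ 'd ^ 'd \<Rightarrow> (real ^ 'd) measure" where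
  "multivariate_normal \<mu> S = density lborel (\<lambda>x. ennreal
     (exp (- ((x - \<mu>) \<bullet> (matrix_inv S *v (x - \<mu>))) / 2) / sqrt ((2 * pi) ^ CARD('d) * det S)))"


section \<open>Weights of the adaptive linear estimating equation\<close>

text \<open>
  These are pathwise definitions: \<open>S0\<close> and \<open>x\<close> are the realised initial matrix and the realised
  covariates \<open>x 1, x 2, \<dots>\<close> (the value \<open>x 0\<close> is never used).
\<close>

definition alee_Sigma :: "real ^ 'd ^ 'd \<Rightarrow> (nat \<Rightarrow> real ^ 'd) \<Rightarrow> nat \<Rightarrow> real ^ 'd ^ 'd" where
  "alee_Sigma S0 x t = S0 + (\<Sum>i=1..t. outer_prod (x i) (x i))"

definition alee_z :: "real ^ 'd ^ 'd \<Rightarrow> (nat \<Rightarrow> real ^ 'd) \<Rightarrow> nat \<Rightarrow> real ^ 'd" where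
  "alee_z S0 x t = inv_sqrt_mat (alee_Sigma S0 x (t - 1)) *v x t"

definition alee_V :: "real ^ 'd ^ 'd \<Rightarrow> (nat \<Rightarrow> real ^ 'd) \<Rightarrow> nat \<Rightarrow> real ^ 'd ^ 'd" where
  "alee_V S0 x t = matrix_inv (mat 1 + (\<Sum>i=1..t. outer_prod (alee_z S0 x i) (alee_z S0 x i)))"

definition alee_w :: "real ^ 'd ^ 'd \<Rightarrow> (nat \<Rightarrow> real ^ 'd) \<Rightarrow> nat \<Rightarrow> real ^ 'd" where
  "alee_w S0 x t =
     sqrt (1 + alee_z S0 x t \<bullet> (alee_V S0 x (t - 1) *v alee_z S0 x t)) *\<^sub>R
       (alee_V S0 x t *v alee_z S0 x t)"

lemma alee_V_0: "alee_V S0 x 0 = mat 1"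
proof -
  have "mat 1 ** matrix_inv (mat 1) = (mat 1 :: real ^ 'd ^ 'd)
      \<and> matrix_inv (mat 1) ** mat 1 = (mat 1 :: real ^ 'd ^ 'd)"
    unfolding matrix_inv_def by (rule someI[of _ "mat 1"]) simp
  then show ?thesis by (simp add: alee_V_def)
qed

end

theory Submission
  imports Defs
begin

text \<open>
  On the event where the estimating equation holds, the normalised error equals \<open>\<Sum>\<^sub>t \<epsilon>\<^sub>t w\<^sub>t\<close>. The
  Sherman--Morrison formula gives \<open>V\<^sub>t\<^sub>-\<^sub>1 - V\<^sub>t = w\<^sub>t w\<^sub>t\<^sup>T\<close>, so for every direction \<open>u\<close> the predictable variance
  \<open>\<Sum>\<^sub>t (u \<bullet> w\<^sub>t)\<^sup>2 = |u|\<^sup>2 - u \<bullet> V\<^sub>n u\<close> is bounded and tends to \<open>|u|\<^sup>2\<close>, while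
  \<open>|u \<bullet> w\<^sub>t|\<^sup>2 \<le> |u|\<^sup>2 \<parallel>\<Sigma>\<^sub>0\<^sup>-\<^sup>1\<parallel>\<close> makes the summands negligible. With \<open>a\<^sub>t = u \<bullet> w\<^sub>t\<close>, the process
  \<open>exp (i \<Sum> a\<^sub>t \<epsilon>\<^sub>t + \<sigma>\<^sup>2 \<Sum> a\<^sub>t\<^sup>2 / 2)\<close> is a martingale up to Taylor remainders, which are controlled after
  discarding the times at which the conditional moment of order \<open>2 + \<delta>\<close> exceeds a level \<open>K\<close>; its mean
  therefore tends to 1. The resulting convergence of characteristic functions upgrades to weak convergence by
  tightness (the second moments are bounded) and Stone--Weierstrass approximation by trigonometric polynomials.
\<close>


section \<open>Positive definite matrices\<close>

text \<open>The weights enter through \<open>inv_sqrt_mat\<close>, a definite description. The root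
  must therefore first be shown to exist, to be unique and to depend measurably on the matrix, since
  otherwise the weights are not known to be predictable. One Lipschitz estimate,
  \<open>sqrt_lipschitz\<close>, settles uniqueness and continuity together without spectral theory.
  Measurability is argued above the identity in the Loewner order, where inversion is Lipschitz with
  constant 1. The initial matrix may change with \<open>n\<close>, so the weights form a triangular
  array over a fixed filtration. Their squares in direction \<open>u\<close> sum to at most
  \<open>|u|^2\<close> on every path, so the compensator is bounded and no stopping time is needed.
  The supremum of the conditional moments is only almost surely finite, possibly without
  expectation. Setting a weight to zero whenever the moment at its time exceeds \<open>K\<close>
  keeps it predictable and changes the sum only on an event of small probability, the same for all
  times and all \<open>n\<close>. The compensator tends to a constant, which is divided out at the
  end.\<close>

lemma matrix_inv_mult:
  fixes A :: "real ^ 'd ^ 'd"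
  assumes "\<And>v. A *v v = 0 \<Longrightarrow> v = 0"
  shows "A ** matrix_inv A = mat 1" "matrix_inv A ** A = mat 1"
proof -
  obtain B where B: "B ** A = mat 1"
    using assms matrix_left_invertible_ker by blast
  then have "A ** B = mat 1 \<and> B ** A = mat 1"
    using matrix_left_right_inverse by blast
  then have "A ** matrix_inv A = mat 1 \<and> matrix_inv A ** A = mat 1"
    unfolding matrix_inv_def by (rule someI)
  then show "A ** matrix_inv A = mat 1" "matrix_inv A ** A = mat 1" by auto
qed

lemma matrix_inv_eqI:
  fixes A :: "real ^ 'd ^ 'd"
  assumes "A ** B = mat 1"
  shows "matrix_inv A = B"
proof -
  have BA: "B ** A = mat 1" using assms matrix_left_right_inverse by blast
  have "v = 0" if "A *v v = 0" for v
    using that BA by (metis matrix_vector_mul_assoc matrix_vector_mul_lid matrix_vector_mult_0_right)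
  then show ?thesis
    by (metis BA matrix_inv_mult(1) matrix_mul_assoc matrix_mul_lid matrix_mul_rid)
qed

lemma inner_matrix_vector_sym:
  fixes A :: "real ^ 'd ^ 'd"
  assumes "transpose A = A"
  shows "(A *v u) \<bullet> v = u \<bullet> (A *v v)"
  by (metis assms dot_lmul_matrix transpose_matrix_vector)

lemma transpose_eqI:
  fixes A :: "real ^ 'd ^ 'd"
  assumes "\<And>u v. (A *v u) \<bullet> v = u \<bullet> (A *v v)"
  shows "transpose A = A"
proof -
  have "u \<bullet> (transpose A *v v) = u \<bullet> (A *v v)" for u v
    by (metis assms dot_lmul_matrix inner_commute transpose_matrix_vector)
  then have "transpose A *v v = A *v v" for v
    by (metis vector_eq_ldot)
  then show ?thesis by (simp add: matrix_eq)
qed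

lemma pos_def_transpose: "pos_def A \<Longrightarrow> transpose A = A"
  by (simp add: pos_def_def)

lemma pos_def_ker: "pos_def A \<Longrightarrow> A *v v = 0 \<Longrightarrow> v = 0"
  by (metis inner_zero_right less_irrefl pos_def_def)

lemmas pos_def_inv = matrix_inv_mult[OF pos_def_ker]

lemma pos_def_inv_apply:
  assumes "pos_def A"
  shows "A *v (matrix_inv A *v v) = v" "matrix_inv A *v (A *v v) = v"
  using assms by (simp_all add: matrix_vector_mul_assoc pos_def_inv)

lemma transpose_matrix_inv:
  assumes "pos_def A"
  shows "transpose (matrix_inv A) = matrix_inv A"
proof (rule transpose_eqI)
  fix u v
  show "(matrix_inv A *v u) \<bullet> v = u \<bullet> (matrix_inv A *v v)"
    by (metis assms inner_matrix_vector_sym pos_def_inv_apply(1) pos_def_transpose)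
qed

lemma pos_def_matrix_inv:
  assumes "pos_def A"
  shows "pos_def (matrix_inv A)"
  unfolding pos_def_def
proof (intro conjI allI impI)
  show "transpose (matrix_inv A) = matrix_inv A"
    using assms by (rule transpose_matrix_inv)
  fix v :: "real ^ 'a" assume "v \<noteq> 0"
  then have "matrix_inv A *v v \<noteq> 0"
    by (metis assms pos_def_inv_apply(1) matrix_vector_mult_0_right)
  then have "0 < (matrix_inv A *v v) \<bullet> (A *v (matrix_inv A *v v))"
    using assms unfolding pos_def_def by blast
  then show "0 < v \<bullet> (matrix_inv A *v v)"
    by (simp add: assms pos_def_inv_apply inner_commute)
qed

text \<open>The constant is the minimum of the quadratic form on the compact unit sphere, that is,
  the smallest eigenvalue, obtained without diagonalisation.\<close>

lemma pos_def_lower_bound: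
  fixes A :: "real ^ 'd ^ 'd"
  assumes "pos_def A"
  obtains m where "m > 0" "\<And>v. m * (v \<bullet> v) \<le> v \<bullet> (A *v v)"
proof -
  let ?S = "sphere (0::real^'d) 1"
  have "continuous_on ?S (\<lambda>v. v \<bullet> (A *v v))"
    by (intro continuous_intros matrix_vector_mult_linear_continuous_on)
  moreover have "?S \<noteq> {}" by (simp add: sphere_eq_empty)
  ultimately obtain v0 where v0: "v0 \<in> ?S" "\<And>v. v \<in> ?S \<Longrightarrow> v0 \<bullet> (A *v v0) \<le> v \<bullet> (A *v v)"
    using continuous_attains_inf[of ?S "\<lambda>v. v \<bullet> (A *v v)"] compact_sphere[of "0::real^'d" 1] by blast
  have pos: "v0 \<bullet> (A *v v0) > 0"
    using assms v0(1) unfolding pos_def_def by (metis norm_zero zero_neq_one mem_sphere_0)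
  have "v0 \<bullet> (A *v v0) * (v \<bullet> v) \<le> v \<bullet> (A *v v)" for v
  proof (cases "v = 0")
    case False
    define u where "u = v /\<^sub>R norm v"
    have v: "v = norm v *\<^sub>R u" using False by (simp add: u_def)
    have "u \<in> ?S" using False by (simp add: u_def)
    then have "v0 \<bullet> (A *v v0) * (norm v)\<^sup>2 \<le> u \<bullet> (A *v u) * (norm v)\<^sup>2"
      using v0(2) by (intro mult_right_mono) auto
    also have "\<dots> = v \<bullet> (A *v v)"
      by (subst (2 3) v) (simp add: matrix_vector_mult_scaleR power2_eq_square)
    finally show ?thesis by (simp add: power2_norm_eq_inner)
  qed simp
  with pos that show ?thesis by blast
qed

section \<open>Square roots of positive definite matrices\<close>

text \<open>\<open>I - Y\<close> is a square root of \<open>I - C\<close> iff \<open>Y\<close> is a fixed point of \<open>Y \<mapsto> (C + Y\<^sup>2) / 2\<close>, which is a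
  contraction on the symmetric operators of norm at most \<open>c\<close>.\<close>

lemma symmetric_sqrt_fixpoint:
  fixes C :: "'a::euclidean_space \<Rightarrow>\<^sub>L 'a"
  assumes sym: "\<And>u v. C u \<bullet> v = u \<bullet> C v" and C: "norm C \<le> c" and c: "c < 1"
  obtains Y :: "'a \<Rightarrow>\<^sub>L 'a" where "\<And>u v. Y u \<bullet> v = u \<bullet> Y v" "norm Y \<le> c" "C + (Y o\<^sub>L Y) = 2 *\<^sub>R Y"
proof -
  \<comment> \<open>Symmetry is imposed vector by vector, as an intersection of closed sets, so that
    \<open>S\<close> is closed and hence complete for \<open>Banach_fix\<close>.\<close>
  define S where "S = {Y :: 'a \<Rightarrow>\<^sub>L 'a. norm Y \<le> c} \<inter> (\<Inter>u. \<Inter>v. {Y :: 'a \<Rightarrow>\<^sub>L 'a. Y u \<bullet> v = u \<bullet> Y v})"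
  define f where "f Y = (1/2) *\<^sub>R (C + (Y o\<^sub>L Y))" for Y :: "'a \<Rightarrow>\<^sub>L 'a"
  have c0: "0 \<le> c" using C norm_ge_zero order_trans by blast
  have "closed S"
    unfolding S_def by (intro closed_Int closed_INT ballI closed_Collect_le closed_Collect_eq continuous_intros)
  note complete_eq_closed[THEN iffD2, OF this]
  moreover have "C \<in> S" using sym C by (simp add: S_def)
  moreover have "f ` S \<subseteq> S"
  proof safe
    fix Y assume Y: "Y \<in> S"
    have "norm (f Y) \<le> (1/2) * (norm C + norm (Y o\<^sub>L Y))"
      unfolding f_def by (simp add: norm_triangle_ineq)
    also have "\<dots> \<le> (1/2) * (c + c * c)"
      using Y C norm_blinfun_compose[of Y Y] c0 mult_mono[of "norm Y" c "norm Y" c]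
      by (auto simp: S_def)
    also have "\<dots> \<le> c" using c c0 mult_left_mono[of c 1 c] by auto
    finally show "f Y \<in> S"
      using Y sym by (auto simp: S_def f_def blinfun.bilinear_simps inner_add)
  qed
  moreover have "dist (f Y) (f Z) \<le> c * dist Y Z" if "Y \<in> S" "Z \<in> S" for Y Z
  proof -
    \<comment> \<open>Noncommutative difference of squares,
      \<open>Y^2 - Z^2 = Y (Y - Z) + (Y - Z) Z\<close>. Both norms are at most \<open>c\<close>, so
      the factor 1/2 leaves the contraction constant \<open>c\<close>.\<close>
    have "f Y - f Z = (1/2) *\<^sub>R ((Y o\<^sub>L (Y - Z)) + ((Y - Z) o\<^sub>L Z))"
      unfolding f_def by (intro blinfun_eqI) (simp add: blinfun.bilinear_simps algebra_simps)
    then have "norm (f Y - f Z) \<le> (1/2) * (norm (Y o\<^sub>L (Y - Z)) + norm ((Y - Z) o\<^sub>L Z))"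
      by (simp add: norm_triangle_ineq)
    also have "\<dots> \<le> (1/2) * (norm Y * norm (Y - Z) + norm (Y - Z) * norm Z)"
      using norm_blinfun_compose[of Y "Y - Z"] norm_blinfun_compose[of "Y - Z" Z] by simp
    also have "\<dots> \<le> (1/2) * (c * norm (Y - Z) + norm (Y - Z) * c)"
      using that by (intro mult_left_mono add_mono mult_mono) (auto simp: S_def c0)
    finally show ?thesis by (simp add: dist_norm mult.commute)
  qed
  ultimately obtain Y where "Y \<in> S" "f Y = Y"
    using Banach_fix[of S c f] c c0 by blast
  moreover from this have "C + (Y o\<^sub>L Y) = 2 *\<^sub>R Y"
    unfolding f_def by (metis scaleR_half_double scaleR_right_distrib scaleR_2 scaleR_scaleR)
  ultimately show ?thesis using that by (auto simp: S_def)
qed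

text \<open>For a small scalar \<open>s > 0\<close> the operator \<open>C = I - s B\<close> has norm
  below 1. The fixed point \<open>Y\<close> then gives \<open>(I - Y)^2 = s B\<close>, and dividing
  \<open>I - Y\<close> by \<open>sqrt s\<close> gives the root.\<close>

lemma pos_def_sqrt_exists:
  fixes B :: "real ^ 'd ^ 'd"
  assumes B: "pos_def B"
  obtains X where "pos_def X" "X ** X = B"
proof -
  obtain m where m: "m > 0" "\<And>v. m * (v \<bullet> v) \<le> v \<bullet> (B *v v)"
    using pos_def_lower_bound[OF B] by blast
  \<comment> \<open>The summand \<open>m\<close> makes \<open>L\<close> positive and at least
    \<open>m\<close>, which is what \<open>s * m \<le> 1\<close>, and so \<open>q \<ge> 0\<close>,
    requires.\<close>
  define L where "L = onorm ((*v) B) + m"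
  have bl: "bounded_linear ((*v) B)" by (rule matrix_vector_mul_bounded_linear)
  have L: "norm (B *v v) \<le> L * norm v" for v
    using onorm[OF bl, of v] m(1) by (simp add: L_def distrib_right add_increasing2)
  have Lm: "L \<ge> m" "L > 0" using onorm_pos_le[OF bl] m(1) by (auto simp: L_def)
  \<comment> \<open>This \<open>s\<close> minimises \<open>1 - 2 s m + s^2 L^2\<close>, the bound
    for the squared norm of \<open>I - s B\<close>; the minimum is \<open>1 - s m\<close>, called
    \<open>q\<close> below.\<close>
  define s where "s = m / L\<^sup>2"
  have s: "s > 0" using m Lm by (simp add: s_def)
  define q where "q = 1 - s * m"
  have "s * m \<le> 1" using Lm m(1) by (simp add: s_def power2_eq_square mult_mono)
  then have q: "0 \<le> q" "q < 1" using s m by (simp_all add: q_def)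
  define C where "C = Blinfun (\<lambda>v. v - s *\<^sub>R (B *v v))"
  have "bounded_linear (\<lambda>v. v - s *\<^sub>R (B *v v))"
    by (intro bounded_linear_sub bounded_linear_ident bounded_linear_const_scaleR bl)
  then have Cap: "C v = v - s *\<^sub>R (B *v v)" for v
    by (simp add: C_def bounded_linear_Blinfun_apply)
  have "norm (C v) \<le> sqrt q * norm v" for v
  proof (rule power2_le_imp_le)
    have "(norm (B *v v))\<^sup>2 \<le> L\<^sup>2 * (v \<bullet> v)"
      using power_mono[OF L[of v], of 2] by (simp add: power_mult_distrib power2_norm_eq_inner)
    then have "s\<^sup>2 * (norm (B *v v))\<^sup>2 \<le> s\<^sup>2 * (L\<^sup>2 * (v \<bullet> v))"
      by (rule mult_left_mono) simp
    also have "\<dots> = s * (m * (v \<bullet> v))" using Lm by (simp add: s_def power2_eq_square)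
    finally have 1: "s\<^sup>2 * (norm (B *v v))\<^sup>2 \<le> s * (m * (v \<bullet> v))" .
    have 2: "s * (m * (v \<bullet> v)) \<le> s * (v \<bullet> (B *v v))"
      using m(2)[of v] s by simp
    have "(norm (C v))\<^sup>2 = v \<bullet> v - 2 * (s * (v \<bullet> (B *v v))) + s\<^sup>2 * (norm (B *v v))\<^sup>2"
      unfolding power2_norm_eq_inner Cap
      by (simp add: inner_diff inner_commute power2_eq_square algebra_simps)
    also have "\<dots> \<le> q * (v \<bullet> v)" using 1 2 by (simp add: q_def algebra_simps)
    finally show "(norm (C v))\<^sup>2 \<le> (sqrt q * norm v)\<^sup>2"
      using q by (simp add: power_mult_distrib power2_norm_eq_inner)
  qed (use q in simp)
  then have "norm C \<le> sqrt q" using q by (intro norm_blinfun_bound) auto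
  moreover have "C u \<bullet> v = u \<bullet> C v" for u v
    using inner_matrix_vector_sym[OF pos_def_transpose[OF B]] by (simp add: Cap inner_diff)
  moreover have "sqrt q < 1" using q by simp
  ultimately obtain Y :: "(real^'d) \<Rightarrow>\<^sub>L (real^'d)" where
    Y: "\<And>u v. Y u \<bullet> v = u \<bullet> Y v" "norm Y \<le> sqrt q" "C + (Y o\<^sub>L Y) = 2 *\<^sub>R Y"
    using symmetric_sqrt_fixpoint[of C "sqrt q"] by blast
  define X where "X = matrix (\<lambda>v. (1 / sqrt s) *\<^sub>R (v - Y v))"
  have "linear (\<lambda>v. (1 / sqrt s) *\<^sub>R (v - Y v))"
    by (intro bounded_linear.linear bounded_linear_const_scaleR bounded_linear_sub
        bounded_linear_ident blinfun.bounded_linear_right)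
  then have Xap: "X *v v = (1 / sqrt s) *\<^sub>R (v - Y v)" for v
    by (simp add: X_def)
  have "X *v (X *v v) = B *v v" for v
  proof -
    have "blinfun_apply (C + (Y o\<^sub>L Y)) v = (2 *\<^sub>R Y) v" using Y(3) by simp
    then have "v - s *\<^sub>R (B *v v) + Y (Y v) = 2 *\<^sub>R Y v"
      by (simp add: blinfun.bilinear_simps Cap)
    then have "v - Y v - Y v + Y (Y v) = s *\<^sub>R (B *v v)"
      by (simp add: algebra_simps scaleR_2)
    moreover have "X *v (X *v v) = (1 / s) *\<^sub>R (v - Y v - Y v + Y (Y v))"
      using s by (simp add: Xap blinfun.bilinear_simps scaleR_diff_right algebra_simps)
    ultimately show ?thesis using s by simp
  qed
  then have "X ** X = B" by (simp add: matrix_eq flip: matrix_vector_mul_assoc)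
  moreover have "pos_def X"
    unfolding pos_def_def
  proof (intro conjI allI impI)
    show "transpose X = X"
      by (rule transpose_eqI) (simp add: Xap inner_diff Y(1))
    fix v :: "real^'d" assume v: "v \<noteq> 0"
    have "v \<bullet> Y v \<le> norm v * norm (Y v)" by (rule norm_cauchy_schwarz)
    also have "\<dots> \<le> norm v * (sqrt q * norm v)"
      using order_trans[OF norm_blinfun[of Y v] mult_right_mono[OF Y(2) norm_ge_zero]]
      by (intro mult_left_mono) auto
    also have "\<dots> < norm v * norm v"
      using v \<open>sqrt q < 1\<close> by simp
    finally show "0 < v \<bullet> (X *v v)"
      using s by (simp add: Xap inner_diff flip: power2_norm_eq_inner power2_eq_square)
  qed
  ultimately show ?thesis using that by blast
qed


section \<open>The Frobenius inner product, row by row, and uniqueness of the square root\<close>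

lemma matrix_mult_row:
  fixes A :: "real ^ 'n ^ 'm" and B :: "real ^ 'k ^ 'n"
  shows "(A ** B) $ i = transpose B *v (A $ i)"
  by (simp add: vec_eq_iff matrix_matrix_mult_def matrix_vector_mult_def transpose_def mult.commute)

lemma inner_transpose:
  fixes A B :: "real ^ 'n ^ 'm"
  shows "transpose A \<bullet> transpose B = A \<bullet> B"
  by (simp add: inner_vec_def transpose_def) (rule sum.swap)

lemma norm_transpose:
  fixes A :: "real ^ 'n ^ 'm"
  shows "norm (transpose A) = norm A"
  by (simp add: norm_eq_sqrt_inner inner_transpose)

lemma transpose_diff:
  fixes A B :: "real ^ 'n ^ 'm"
  shows "transpose (A - B) = transpose A - transpose B"
  by (simp add: vec_eq_iff transpose_def)

text \<open>Pair \<open>X\<^sup>2 - Z\<^sup>2 = X D + D Z\<close>, where \<open>D = X - Z\<close>, with \<open>D\<close> in the Frobenius inner product.\<close>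

lemma sqrt_lipschitz:
  fixes X Z :: "real ^ 'd ^ 'd"
  assumes X: "transpose X = X" "\<And>v. m * (v \<bullet> v) \<le> v \<bullet> (X *v v)" and Z: "pos_def Z"
  shows "m * norm (X - Z) \<le> norm (X ** X - Z ** Z)"
proof -
  define D where "D = X - Z"
  have D: "transpose D = D" using X(1) Z by (simp add: D_def transpose_diff pos_def_def)
  \<comment> \<open>Transposition moves \<open>X\<close> to the right of \<open>D\<close>, where it
    acts on each row of \<open>D\<close>, so its lower bound applies row by row.\<close>
  have "D \<bullet> (X ** D) = D \<bullet> (D ** X)"
    by (metis D X(1) inner_transpose matrix_transpose_mul)
  also have "\<dots> = (\<Sum>i\<in>UNIV. D $ i \<bullet> (X *v (D $ i)))"
    by (simp add: inner_vec_def[of D] matrix_mult_row X(1))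
  also have "\<dots> \<ge> (\<Sum>i\<in>UNIV. m * (D $ i \<bullet> D $ i))"
    by (intro sum_mono X(2))
  finally have 1: "m * (D \<bullet> D) \<le> D \<bullet> (X ** D)"
    by (simp add: inner_vec_def[of D] sum_distrib_left)
  have "0 \<le> v \<bullet> (Z *v v)" for v
    using Z unfolding pos_def_def by (cases "v = 0") (auto intro: less_imp_le)
  then have 2: "0 \<le> D \<bullet> (D ** Z)"
    using pos_def_transpose[OF Z] by (simp add: inner_vec_def[of D] matrix_mult_row sum_nonneg)
  have "X ** X - Z ** Z = X ** D + D ** Z"
    by (simp add: D_def matrix_eq matrix_vector_mult_add_rdistrib matrix_vector_mult_diff_rdistrib
        matrix_vector_mult_diff_distrib flip: matrix_vector_mul_assoc)
  then have "m * (D \<bullet> D) \<le> D \<bullet> (X ** X - Z ** Z)"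
    using 1 2 by (simp add: inner_add_right)
  also have "\<dots> \<le> norm D * norm (X ** X - Z ** Z)" by (rule norm_cauchy_schwarz)
  finally have "norm D * (m * norm D) \<le> norm D * norm (X ** X - Z ** Z)"
    by (simp add: power2_norm_eq_inner[symmetric] power2_eq_square algebra_simps)
  then show ?thesis
    by (cases "norm D = 0") (auto simp: D_def)
qed

text \<open>Two roots of the same matrix satisfy \<open>m * norm (X - Z) \<le> 0\<close> by
  \<open>sqrt_lipschitz\<close>, so the definite description is well defined.\<close>

lemma inv_sqrt_mat:
  fixes A :: "real ^ 'd ^ 'd"
  assumes "pos_def A"
  shows "pos_def (inv_sqrt_mat A)" "inv_sqrt_mat A ** inv_sqrt_mat A = matrix_inv A"
proof -
  obtain X where X: "pos_def X" "X ** X = matrix_inv A"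
    using pos_def_sqrt_exists[OF pos_def_matrix_inv[OF assms]] by blast
  obtain m where m: "m > 0" "\<And>v. m * (v \<bullet> v) \<le> v \<bullet> (X *v v)"
    using pos_def_lower_bound[OF X(1)] by blast
  have "Z = X" if "pos_def Z \<and> Z ** Z = matrix_inv A" for Z
    using sqrt_lipschitz[OF pos_def_transpose[OF X(1)] m(2), of Z] that X m(1)
    by (simp add: mult_le_0_iff)
  then have "pos_def (inv_sqrt_mat A) \<and> inv_sqrt_mat A ** inv_sqrt_mat A = matrix_inv A"
    unfolding inv_sqrt_mat_def using X by (intro theI'[of "\<lambda>B. pos_def B \<and> B ** B = matrix_inv A"]) blast
  then show "pos_def (inv_sqrt_mat A)" "inv_sqrt_mat A ** inv_sqrt_mat A = matrix_inv A" by auto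
qed

section \<open>Matrices above the identity\<close>

lemma loewner_ge_mat_1_iff:
  fixes A :: "real ^ 'd ^ 'd"
  shows "loewner_ge A (mat 1) \<longleftrightarrow> transpose A = A \<and> (\<forall>v. v \<bullet> v \<le> v \<bullet> (A *v v))"
  unfolding loewner_ge_def pos_semidef_def
  by (auto simp: transpose_diff matrix_vector_mult_diff_rdistrib inner_diff_right transpose_mat)

lemma loewner_ge_mat_1_pos_def:
  assumes "loewner_ge A (mat 1)"
  shows "pos_def A"
  using assms unfolding loewner_ge_mat_1_iff pos_def_def by (metis inner_gt_zero_iff less_le_trans)

text \<open>With \<open>u = A^-1 v\<close>, the assumption gives
  \<open>u \<bullet> u \<le> u \<bullet> A u = u \<bullet> v\<close>, and Cauchy--Schwarz
  finishes.\<close>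

lemma norm_matrix_inv_mult_le:
  assumes "loewner_ge A (mat 1)"
  shows "norm (matrix_inv A *v v) \<le> norm v"
proof -
  let ?u = "matrix_inv A *v v"
  have "?u \<bullet> ?u \<le> ?u \<bullet> (A *v ?u)" using assms by (simp add: loewner_ge_mat_1_iff)
  also have "\<dots> = ?u \<bullet> v"
    by (simp add: loewner_ge_mat_1_pos_def[OF assms] pos_def_inv_apply)
  also have "\<dots> \<le> norm ?u * norm v" by (rule norm_cauchy_schwarz)
  finally have "norm ?u * norm ?u \<le> norm ?u * norm v"
    by (simp add: power2_norm_eq_inner[symmetric] power2_eq_square)
  then show ?thesis by (cases "norm ?u = 0") auto
qed

lemma norm_mult_contraction_le:
  fixes B M :: "real ^ 'd ^ 'd"
  assumes "transpose B = B" "\<And>v. norm (B *v v) \<le> norm v"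
  shows "norm (M ** B) \<le> norm M" "norm (B ** M) \<le> norm M"
proof -
  show *: "norm (M ** B) \<le> norm M" for M
    by (rule norm_le_componentwise_cart) (simp add: matrix_mult_row assms)
  have "norm (B ** M) = norm (transpose M ** B)"
    by (metis assms(1) matrix_transpose_mul norm_transpose)
  also have "\<dots> \<le> norm M" using *[of "transpose M"] by (simp add: norm_transpose)
  finally show "norm (B ** M) \<le> norm M" .
qed

text \<open>Resolvent identity \<open>B^-1 - A^-1 = B^-1 (A - B) A^-1\<close>: both outer factors
  are contractions and cannot increase the Frobenius norm.\<close>

lemma matrix_inv_lipschitz:
  fixes A B :: "real ^ 'd ^ 'd"
  assumes A: "loewner_ge A (mat 1)" and B: "loewner_ge B (mat 1)"
  shows "norm (matrix_inv B - matrix_inv A) \<le> norm (B - A)"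
proof -
  note pd = loewner_ge_mat_1_pos_def[OF A] loewner_ge_mat_1_pos_def[OF B]
  have "matrix_inv B - matrix_inv A = matrix_inv B ** ((A - B) ** matrix_inv A)"
    by (simp add: matrix_eq matrix_vector_mult_diff_rdistrib matrix_vector_mult_diff_distrib
        pos_def_inv_apply pd flip: matrix_vector_mul_assoc)
  also have "norm \<dots> \<le> norm ((A - B) ** matrix_inv A)"
    by (intro norm_mult_contraction_le transpose_matrix_inv pd norm_matrix_inv_mult_le B)
  also have "\<dots> \<le> norm (A - B)"
    by (intro norm_mult_contraction_le transpose_matrix_inv pd norm_matrix_inv_mult_le A)
  finally show ?thesis by (simp add: norm_minus_commute)
qed

lemma continuous_on_matrix_inv:
  "continuous_on {A :: real ^ 'd ^ 'd. loewner_ge A (mat 1)} matrix_inv"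
  unfolding continuous_on_iff dist_norm
  by (blast intro: order_le_less_trans[OF matrix_inv_lipschitz])

text \<open>The estimate used at \<open>A\<close> has constant \<open>1 / m\<close>, with
  \<open>m\<close> a lower bound for the root at \<open>A\<close>. It depends on the base point, so
  the argument gives continuity at each point rather than a uniform Lipschitz bound.\<close>

lemma continuous_on_inv_sqrt_mat:
  "continuous_on {A :: real ^ 'd ^ 'd. loewner_ge A (mat 1)} inv_sqrt_mat"
  unfolding continuous_on_def
proof
  fix A :: "real ^ 'd ^ 'd" assume A: "A \<in> {A. loewner_ge A (mat 1)}"
  let ?F = "at A within {A. loewner_ge A (mat 1)}"
  have pd: "pos_def A" using A loewner_ge_mat_1_pos_def by blast
  obtain m where m: "m > 0" "\<And>v. m * (v \<bullet> v) \<le> v \<bullet> (inv_sqrt_mat A *v v)"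
    using pos_def_lower_bound[OF inv_sqrt_mat(1)[OF pd]] by blast
  have "((\<lambda>B. (1 / m) *\<^sub>R matrix_inv B) \<longlongrightarrow> (1 / m) *\<^sub>R matrix_inv A) ?F"
    using continuous_on_matrix_inv A unfolding continuous_on_def by (intro tendsto_intros) auto
  moreover have "\<forall>\<^sub>F B in ?F. dist (inv_sqrt_mat B) (inv_sqrt_mat A)
      \<le> dist ((1 / m) *\<^sub>R matrix_inv B) ((1 / m) *\<^sub>R matrix_inv A)"
    unfolding eventually_at_filter
  proof (intro always_eventually allI impI)
    fix B :: "real ^ 'd ^ 'd" assume "B \<in> {A. loewner_ge A (mat 1)}"
    then have pd': "pos_def B" using loewner_ge_mat_1_pos_def by blast
    have "m * norm (inv_sqrt_mat A - inv_sqrt_mat B) \<le> norm (matrix_inv A - matrix_inv B)"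
      using sqrt_lipschitz[OF pos_def_transpose[OF inv_sqrt_mat(1)[OF pd]] m(2) inv_sqrt_mat(1)[OF pd']]
      by (simp add: inv_sqrt_mat(2) pd pd')
    then have "norm (inv_sqrt_mat B - inv_sqrt_mat A) \<le> (1 / m) * norm (matrix_inv B - matrix_inv A)"
      using m(1) by (simp add: field_simps norm_minus_commute)
    also have "\<dots> = norm ((1 / m) *\<^sub>R (matrix_inv B - matrix_inv A))"
      using m(1) by simp
    finally show "dist (inv_sqrt_mat B) (inv_sqrt_mat A)
      \<le> dist ((1 / m) *\<^sub>R matrix_inv B) ((1 / m) *\<^sub>R matrix_inv A)"
      by (simp only: dist_norm scaleR_diff_right)
  qed
  ultimately show "(inv_sqrt_mat \<longlongrightarrow> inv_sqrt_mat A) ?F"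
    by (rule metric_tendsto_imp_tendsto)
qed

section \<open>The operator norm, and measurability through continuity on a subset\<close>

lemma norm_mult_le_op_norm: "norm (A *v v) \<le> op_norm A * norm v"
  unfolding op_norm_def using onorm[OF matrix_vector_mul_bounded_linear] .

lemma op_norm_nonneg: "0 \<le> op_norm A"
  unfolding op_norm_def by (rule onorm_pos_le) (rule matrix_vector_mul_bounded_linear)

lemma continuous_on_op_norm: "continuous_on S (op_norm :: real ^ 'n ^ 'm \<Rightarrow> real)"
proof -
  let ?g = "\<lambda>A :: real ^ 'n ^ 'm. Blinfun ((*v) A)"
  have ap: "blinfun_apply (?g A) v = A *v v" for A v
    by (simp add: bounded_linear_Blinfun_apply)
  have "linear ?g"
    by (intro linearI blinfun_eqI)
      (simp_all add: ap blinfun.bilinear_simps matrix_vector_mult_add_rdistrib scaleR_matrix_vector_assoc)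
  then have "continuous_on S ?g"
    by (intro linear_continuous_on) (simp add: linear_conv_bounded_linear)
  moreover have eq: "op_norm = (\<lambda>A. norm (?g A))"
    unfolding op_norm_def norm_blinfun.rep_eq ap by (rule refl)
  ultimately show ?thesis unfolding eq by (intro continuous_on_norm)
qed

text \<open>Continuity of \<open>matrix_inv\<close> and \<open>inv_sqrt_mat\<close> is available on
  the matrices above the identity, hence the passage through the restricted space.\<close>

lemma borel_measurable_continuous_on_comp:
  assumes "continuous_on S g" "f \<in> borel_measurable M" "\<And>\<omega>. \<omega> \<in> space M \<Longrightarrow> f \<omega> \<in> S"
  shows "(\<lambda>\<omega>. g (f \<omega>)) \<in> borel_measurable M"
proof -
  have "f \<in> M \<rightarrow>\<^sub>M restrict_space borel S"
    using assms(2,3) by (intro measurable_restrict_space2) auto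
  then show ?thesis
    using borel_measurable_continuous_on_restrict[OF assms(1)] by (rule measurable_compose)
qed


section \<open>The weights\<close>

lemma outer_prod_mult: "outer_prod u v *v p = (v \<bullet> p) *\<^sub>R u"
  by (simp add: vec_eq_iff outer_prod_def matrix_vector_mult_def inner_vec_def sum_distrib_left ac_simps)

lemma transpose_add:
  fixes A B :: "real ^ 'n ^ 'm"
  shows "transpose (A + B) = transpose A + transpose B"
  by (simp add: vec_eq_iff transpose_def)

lemma sum_matrix_vector_mult:
  fixes A :: "'i \<Rightarrow> real ^ 'n ^ 'm"
  shows "(\<Sum>i\<in>I. A i) *v v = (\<Sum>i\<in>I. A i *v v)"
  by (induct I rule: infinite_finite_induct) (simp_all add: matrix_vector_mult_add_rdistrib)

lemma quad_add_sum_outer_prod: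
  fixes z :: "'i \<Rightarrow> real ^ 'd"
  shows "v \<bullet> ((A + (\<Sum>i\<in>I. outer_prod (z i) (z i))) *v v) = v \<bullet> (A *v v) + (\<Sum>i\<in>I. (z i \<bullet> v)\<^sup>2)"
  by (simp add: matrix_vector_mult_add_rdistrib sum_matrix_vector_mult outer_prod_mult inner_add_right
      inner_sum_right power2_eq_square inner_commute)

lemma loewner_ge_add_outer_prods:
  fixes z :: "'i \<Rightarrow> real ^ 'd"
  assumes "loewner_ge A (mat 1)"
  shows "loewner_ge (A + (\<Sum>i\<in>I. outer_prod (z i) (z i))) (mat 1)"
proof -
  have "transpose (\<Sum>i\<in>I. outer_prod (z i) (z i)) = (\<Sum>i\<in>I. outer_prod (z i) (z i))"
    by (simp add: vec_eq_iff transpose_def outer_prod_def mult.commute)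
  then show ?thesis
    using assms by (simp add: loewner_ge_mat_1_iff transpose_add quad_add_sum_outer_prod add_increasing2 sum_nonneg)
qed

lemma loewner_ge_mat_1_refl: "loewner_ge (mat 1) (mat 1)"
  by (simp add: loewner_ge_mat_1_iff transpose_mat)

text \<open>Let \<open>A p = u\<close> and \<open>B q = u\<close>. Expanding
  \<open>0 \<le> (p - q) \<bullet> A (p - q)\<close> and replacing \<open>q \<bullet> A q\<close> by
  the larger \<open>q \<bullet> B q = u \<bullet> q\<close> leaves exactly the claim.\<close>

lemma inner_matrix_inv_antimono:
  fixes A B :: "real ^ 'd ^ 'd"
  assumes A: "pos_def A" and B: "pos_def B" and le: "\<And>v. v \<bullet> (A *v v) \<le> v \<bullet> (B *v v)"
  shows "u \<bullet> (matrix_inv B *v u) \<le> u \<bullet> (matrix_inv A *v u)"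
proof -
  define p q where "p = matrix_inv A *v u" and "q = matrix_inv B *v u"
  have Ap: "A *v p = u" and Bq: "B *v q = u" by (simp_all add: p_def q_def pos_def_inv_apply A B)
  have sym: "p \<bullet> (A *v q) = q \<bullet> u"
    using inner_matrix_vector_sym[OF pos_def_transpose[OF A], of p q] by (simp add: Ap inner_commute)
  have "0 \<le> (p - q) \<bullet> (A *v (p - q))"
    using A unfolding pos_def_def by (cases "p - q = 0") (auto intro: less_imp_le)
  also have "\<dots> = u \<bullet> p - 2 * (u \<bullet> q) + q \<bullet> (A *v q)"
    using sym by (simp add: matrix_vector_mult_diff_distrib inner_diff Ap inner_commute)
  also have "\<dots> \<le> u \<bullet> p - 2 * (u \<bullet> q) + u \<bullet> q"
    using le[of q] by (simp add: Bq inner_commute)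
  finally show ?thesis by (simp add: p_def q_def)
qed

context
  fixes S0 :: "real ^ 'd ^ 'd" and x :: "nat \<Rightarrow> real ^ 'd"
  assumes S0: "loewner_ge S0 (mat 1)"
begin

lemma loewner_ge_alee_Sigma: "loewner_ge (alee_Sigma S0 x t) (mat 1)"
  unfolding alee_Sigma_def by (rule loewner_ge_add_outer_prods[OF S0])

lemma alee_V_contraction: "norm (alee_V S0 x t *v v) \<le> norm v"
  unfolding alee_V_def
  by (intro norm_matrix_inv_mult_le loewner_ge_add_outer_prods loewner_ge_mat_1_refl)

lemma pos_def_alee_V: "pos_def (alee_V S0 x t)"
  unfolding alee_V_def
  by (intro pos_def_matrix_inv loewner_ge_mat_1_pos_def loewner_ge_add_outer_prods loewner_ge_mat_1_refl)

text \<open>Symmetry of the root turns the squared norm into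
  \<open>x_t \<bullet> \<Sigma>^-1 x_t\<close>. Earlier covariates only enlarge the matrix, so its
  inverse is dominated by that of \<open>S0\<close>, a bound free of \<open>t\<close>.\<close>

lemma norm_alee_z:
  assumes "norm (x t) \<le> 1"
  shows "(norm (alee_z S0 x t))\<^sup>2 \<le> op_norm (matrix_inv S0)"
proof -
  let ?S = "alee_Sigma S0 x (t - 1)"
  have pd: "pos_def ?S" by (rule loewner_ge_mat_1_pos_def[OF loewner_ge_alee_Sigma])
  have "(norm (alee_z S0 x t))\<^sup>2 = x t \<bullet> (inv_sqrt_mat ?S *v (inv_sqrt_mat ?S *v x t))"
    unfolding power2_norm_eq_inner alee_z_def
    by (rule inner_matrix_vector_sym[OF pos_def_transpose[OF inv_sqrt_mat(1)[OF pd]]])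
  also have "\<dots> = x t \<bullet> (matrix_inv ?S *v x t)"
    by (simp only: matrix_vector_mul_assoc inv_sqrt_mat(2)[OF pd])
  also have "\<dots> \<le> x t \<bullet> (matrix_inv S0 *v x t)"
    by (rule inner_matrix_inv_antimono[OF loewner_ge_mat_1_pos_def[OF S0] pd])
      (simp add: alee_Sigma_def quad_add_sum_outer_prod sum_nonneg)
  also have "\<dots> \<le> norm (x t) * norm (matrix_inv S0 *v x t)" by (rule norm_cauchy_schwarz)
  also have "\<dots> \<le> norm (x t) * (op_norm (matrix_inv S0) * norm (x t))"
    by (intro mult_left_mono norm_mult_le_op_norm) simp
  also have "\<dots> \<le> 1 * (op_norm (matrix_inv S0) * 1)"
    using assms by (intro mult_mono) (simp_all add: op_norm_nonneg)
  finally show ?thesis by simp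
qed

text \<open>The Sherman--Morrison formula; the weights are designed to make it a rank one decomposition.\<close>

lemma
  fixes t :: nat and p :: "real ^ 'd"
  assumes t: "t \<ge> 1"
  shows alee_V_diff: "alee_V S0 x (t - 1) *v p - alee_V S0 x t *v p = (alee_w S0 x t \<bullet> p) *\<^sub>R alee_w S0 x t"
    and norm_alee_w: "norm (alee_w S0 x t) \<le> norm (alee_z S0 x t)"
proof -
  define z where "z = alee_z S0 x t"
  define V where "V = alee_V S0 x (t - 1)"
  define V' where "V' = alee_V S0 x t"
  define A where "A = mat 1 + (\<Sum>i=1..t-1. outer_prod (alee_z S0 x i) (alee_z S0 x i))"
  \<comment> \<open>The condition \<open>t \<ge> 1\<close> makes \<open>t - 1\<close> a true
    predecessor, so the last summand can be split off.\<close>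
  have A': "mat 1 + (\<Sum>i=1..t. outer_prod (alee_z S0 x i) (alee_z S0 x i)) = A + outer_prod z z"
    using t by (cases t) (simp_all add: A_def z_def add.assoc)
  have pdA: "pos_def A" unfolding A_def
    by (intro loewner_ge_mat_1_pos_def loewner_ge_add_outer_prods loewner_ge_mat_1_refl)
  have pdA': "pos_def (A + outer_prod z z)" unfolding A'[symmetric]
    by (intro loewner_ge_mat_1_pos_def loewner_ge_add_outer_prods loewner_ge_mat_1_refl)
  have V: "V = matrix_inv A" by (simp add: V_def alee_V_def A_def)
  have V': "V' = matrix_inv (A + outer_prod z z)" by (simp only: V'_def alee_V_def A')
  define s where "s = z \<bullet> (V *v z)"
  have s: "s \<ge> 0"
    unfolding s_def V using pos_def_matrix_inv[OF pdA] unfolding pos_def_def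
    by (cases "z = 0") (auto intro: less_imp_le)
  have symV: "z \<bullet> (V *v p) = (V *v z) \<bullet> p" for p
    unfolding V using inner_matrix_vector_sym[OF transpose_matrix_inv[OF pdA]] by simp
  have diff: "V *v p - V' *v p = ((V *v z) \<bullet> p) *\<^sub>R (V' *v z)" for p
  proof -
    have "(A + outer_prod z z) *v (V *v p) = p + ((V *v z) \<bullet> p) *\<^sub>R z"
      by (simp add: matrix_vector_mult_add_rdistrib outer_prod_mult V pos_def_inv_apply pdA symV[unfolded V])
    then have "V' *v ((A + outer_prod z z) *v (V *v p)) = V' *v p + ((V *v z) \<bullet> p) *\<^sub>R (V' *v z)"
      by (simp add: matrix_vector_right_distrib matrix_vector_mult_scaleR)
    then show ?thesis by (simp add: V' pos_def_inv_apply pdA')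
  qed
  \<comment> \<open>Taking \<open>p = z\<close> in \<open>diff\<close> gives
    \<open>V z - V' z = s V' z\<close>. Substituting this back, the factor \<open>1 + s\<close> is
    shared as \<open>sqrt (1 + s)\<close> between the two copies of the weight.\<close>
  have Vz: "V *v z = (1 + s) *\<^sub>R (V' *v z)"
    using diff[of z] by (simp add: s_def inner_commute algebra_simps)
  have w: "alee_w S0 x t = sqrt (1 + s) *\<^sub>R (V' *v z)"
    by (simp add: alee_w_def z_def V_def V'_def s_def)
  show "alee_V S0 x (t - 1) *v p - alee_V S0 x t *v p = (alee_w S0 x t \<bullet> p) *\<^sub>R alee_w S0 x t"
  proof -
    have "sqrt (1 + s) * a * sqrt (1 + s) = (1 + s) * a" for a
      using s by (simp add: mult.commute mult.left_commute)
    then show ?thesis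
      using diff[of p] s unfolding w V_def[symmetric] V'_def[symmetric] by (simp add: Vz)
  qed
  \<comment> \<open>As \<open>sqrt (1 + s) \<le> 1 + s\<close>, the weight is no longer than
    \<open>V z\<close>, and \<open>V\<close> is a contraction.\<close>
  have "norm (alee_w S0 x t) \<le> norm ((1 + s) *\<^sub>R (V' *v z))"
    using s unfolding w norm_scaleR by (intro mult_right_mono) (auto intro!: real_le_lsqrt simp: power2_eq_square)
  also have "\<dots> \<le> norm z"
    unfolding Vz[symmetric] V_def by (rule alee_V_contraction)
  finally show "norm (alee_w S0 x t) \<le> norm (alee_z S0 x t)" by (simp add: z_def)
qed

lemma sum_inner_alee_w_sq:
  "(\<Sum>t=1..n. (u \<bullet> alee_w S0 x t)\<^sup>2) = u \<bullet> u - u \<bullet> (alee_V S0 x n *v u)"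
proof (induct n)
  case 0
  then show ?case by (simp add: alee_V_0)
next
  case (Suc n)
  have "u \<bullet> (alee_V S0 x n *v u - alee_V S0 x (Suc n) *v u) = (u \<bullet> alee_w S0 x (Suc n))\<^sup>2"
    using alee_V_diff[of "Suc n" u] by (simp add: power2_eq_square inner_commute)
  then show ?case using Suc by (simp add: inner_diff_right)
qed

lemma sum_inner_alee_w_sq_le: "(\<Sum>t=1..n. (u \<bullet> alee_w S0 x t)\<^sup>2) \<le> (norm u)\<^sup>2"
proof -
  have "0 \<le> u \<bullet> (alee_V S0 x n *v u)"
    using pos_def_alee_V[of n] unfolding pos_def_def by (cases "u = 0") (auto intro: less_imp_le)
  then show ?thesis unfolding sum_inner_alee_w_sq by (simp add: power2_norm_eq_inner)
qed

lemma sum_inner_alee_w_sq_diff: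
  "\<bar>(\<Sum>t=1..n. (u \<bullet> alee_w S0 x t)\<^sup>2) - (norm u)\<^sup>2\<bar> \<le> (norm u)\<^sup>2 * op_norm (alee_V S0 x n)"
proof -
  have "\<bar>u \<bullet> (alee_V S0 x n *v u)\<bar> \<le> norm u * norm (alee_V S0 x n *v u)"
    by (rule Cauchy_Schwarz_ineq2)
  also have "\<dots> \<le> norm u * (op_norm (alee_V S0 x n) * norm u)"
    by (intro mult_left_mono norm_mult_le_op_norm) simp
  finally show ?thesis
    unfolding sum_inner_alee_w_sq by (simp add: power2_norm_eq_inner[symmetric] power2_eq_square ac_simps)
qed

lemma inner_alee_w_le:
  assumes "t \<ge> 1" "norm (x t) \<le> 1"
  shows "\<bar>u \<bullet> alee_w S0 x t\<bar> \<le> norm u * sqrt (op_norm (matrix_inv S0))"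
proof -
  have "\<bar>u \<bullet> alee_w S0 x t\<bar> \<le> norm u * norm (alee_w S0 x t)" by (rule Cauchy_Schwarz_ineq2)
  also have "\<dots> \<le> norm u * sqrt (op_norm (matrix_inv S0))"
    using norm_alee_z[OF assms(2)] norm_alee_w[OF assms(1)]
    by (intro mult_left_mono) (auto intro: order_trans real_le_rsqrt)
  finally show ?thesis .
qed

end

section \<open>Measurability of the weights\<close>

lemma borel_measurable_outer_prod [measurable (raw)]:
  fixes u :: "'a \<Rightarrow> real ^ 'm" and v :: "'a \<Rightarrow> real ^ 'n"
  assumes "u \<in> borel_measurable N" "v \<in> borel_measurable N"
  shows "(\<lambda>\<omega>. outer_prod (u \<omega>) (v \<omega>)) \<in> borel_measurable N"
  using assms by (rule borel_measurable_continuous_Pair)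
    (auto simp: outer_prod_def intro!: continuous_intros)

lemma borel_measurable_matrix_vector_mult [measurable (raw)]:
  fixes A :: "'a \<Rightarrow> real ^ 'n ^ 'm" and v :: "'a \<Rightarrow> real ^ 'n"
  assumes "A \<in> borel_measurable N" "v \<in> borel_measurable N"
  shows "(\<lambda>\<omega>. A \<omega> *v v \<omega>) \<in> borel_measurable N"
  using assms by (rule borel_measurable_continuous_Pair)
    (auto simp: matrix_vector_mult_def intro!: continuous_intros)

lemma borel_measurable_matrix_inv:
  assumes "S \<in> borel_measurable N" "\<And>\<omega>. \<omega> \<in> space N \<Longrightarrow> loewner_ge (S \<omega>) (mat 1)"
  shows "(\<lambda>\<omega>. matrix_inv (S \<omega>)) \<in> borel_measurable N"
  using continuous_on_matrix_inv assms(1)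
  by (rule borel_measurable_continuous_on_comp) (use assms(2) in auto)

text \<open>The space \<open>N\<close> is left open for two uses: \<open>F t\<close> with index
  bound \<open>Suc t\<close>, which yields predictability of the weights, and \<open>M\<close>
  itself, for the stability condition.\<close>

context
  fixes N :: "'a measure" and S0 :: "'a \<Rightarrow> real ^ 'd ^ 'd" and x :: "nat \<Rightarrow> 'a \<Rightarrow> real ^ 'd" and t :: nat
  assumes S0: "S0 \<in> borel_measurable N" "\<And>\<omega>. \<omega> \<in> space N \<Longrightarrow> loewner_ge (S0 \<omega>) (mat 1)"
    and x: "\<And>i. 1 \<le> i \<Longrightarrow> i \<le> t \<Longrightarrow> x i \<in> borel_measurable N"
begin

lemma borel_measurable_alee_z:
  assumes "1 \<le> i" "i \<le> t"
  shows "(\<lambda>\<omega>. alee_z (S0 \<omega>) (\<lambda>t. x t \<omega>) i) \<in> borel_measurable N"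
proof -
  note [measurable] = x[OF assms] S0(1)
  have [measurable]: "x j \<in> borel_measurable N" if "j \<in> {1..i-1}" for j
    using that assms by (intro x) auto
  have "(\<lambda>\<omega>. alee_Sigma (S0 \<omega>) (\<lambda>t. x t \<omega>) (i - 1)) \<in> borel_measurable N"
    unfolding alee_Sigma_def by (intro borel_measurable_add borel_measurable_sum borel_measurable_outer_prod) auto
  then have [measurable]: "(\<lambda>\<omega>. inv_sqrt_mat (alee_Sigma (S0 \<omega>) (\<lambda>t. x t \<omega>) (i - 1))) \<in> borel_measurable N"
    by (rule borel_measurable_continuous_on_comp[OF continuous_on_inv_sqrt_mat])
      (auto intro: loewner_ge_alee_Sigma S0(2))
  show ?thesis unfolding alee_z_def by measurable
qed

lemma borel_measurable_alee_V:
  assumes "i \<le> t"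
  shows "(\<lambda>\<omega>. alee_V (S0 \<omega>) (\<lambda>t. x t \<omega>) i) \<in> borel_measurable N"
  unfolding alee_V_def
  using assms
  by (intro borel_measurable_matrix_inv loewner_ge_add_outer_prods loewner_ge_mat_1_refl
      borel_measurable_add borel_measurable_sum borel_measurable_outer_prod borel_measurable_alee_z) auto

lemma borel_measurable_alee_w:
  assumes "1 \<le> i" "i \<le> t"
  shows "(\<lambda>\<omega>. alee_w (S0 \<omega>) (\<lambda>t. x t \<omega>) i) \<in> borel_measurable N"
proof -
  note [measurable] = borel_measurable_alee_z[OF assms] borel_measurable_alee_V[OF assms(2)]
  have [measurable]: "(\<lambda>\<omega>. alee_V (S0 \<omega>) (\<lambda>t. x t \<omega>) (i - 1)) \<in> borel_measurable N"
    using assms by (intro borel_measurable_alee_V) auto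
  show ?thesis unfolding alee_w_def by measurable
qed

end


section \<open>Weak convergence from characteristic functions\<close>

text \<open>The free phase \<open>b\<close> covers sines as well as cosines, and
  \<open>u = 0\<close> gives constants; this makes the real span an algebra, as Stone--Weierstrass
  requires.\<close>

inductive trig_poly :: "('a::real_inner \<Rightarrow> real) \<Rightarrow> bool" where
  cos: "trig_poly (\<lambda>x. a * cos (u \<bullet> x + b))"
| add: "trig_poly f \<Longrightarrow> trig_poly g \<Longrightarrow> trig_poly (\<lambda>x. f x + g x)"

lemma trig_poly_const: "trig_poly (\<lambda>x. c)"
  using trig_poly.cos[of c 0 0] by simp

text \<open>The product-to-sum formula for cosines handles two generators; the nested inductions
  extend it to sums in either factor.\<close>

lemma trig_poly_mult:
  assumes "trig_poly f" "trig_poly g"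
  shows "trig_poly (\<lambda>x. f x * g x)"
  using assms
proof (induct f arbitrary: g rule: trig_poly.induct)
  case (cos a u b)
  from cos show ?case
  proof (induct g rule: trig_poly.induct)
    case (cos a' u' b')
    have "(\<lambda>x. a * cos (u \<bullet> x + b) * (a' * cos (u' \<bullet> x + b'))) =
      (\<lambda>x. (a * a' / 2) * cos ((u - u') \<bullet> x + (b - b')) + (a * a' / 2) * cos ((u + u') \<bullet> x + (b + b')))"
    proof
      fix x
      have eq: "(u - u') \<bullet> x + (b - b') = (u \<bullet> x + b) - (u' \<bullet> x + b')"
        "(u + u') \<bullet> x + (b + b') = (u \<bullet> x + b) + (u' \<bullet> x + b')"
        by (simp_all add: inner_diff_left inner_add_left)
      show "a * cos (u \<bullet> x + b) * (a' * cos (u' \<bullet> x + b')) =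
        (a * a' / 2) * cos ((u - u') \<bullet> x + (b - b')) + (a * a' / 2) * cos ((u + u') \<bullet> x + (b + b'))"
        unfolding eq cos_add cos_diff by (simp add: field_simps)
    qed
    then show ?case by (simp only: trig_poly.intros)
  next
    case (add f g)
    then show ?case using trig_poly.add by (simp add: distrib_left)
  qed
next
  case (add f1 f2)
  then show ?case using trig_poly.add[OF add(2,4)] by (simp add: distrib_right)
qed

lemma trig_poly_continuous: "trig_poly f \<Longrightarrow> continuous_on S f"
  by (induct f rule: trig_poly.induct) (auto intro!: continuous_intros)

lemma trig_poly_bounded: "trig_poly f \<Longrightarrow> \<exists>G. \<forall>x. \<bar>f x\<bar> \<le> G"
proof (induct f rule: trig_poly.induct)
  case (cos a u b)
  have "\<bar>a * cos (u \<bullet> x + b)\<bar> \<le> \<bar>a\<bar>" for x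
    using mult_left_mono[OF abs_cos_le_one abs_ge_zero] by (simp add: abs_mult mult_left_le)
  then show ?case by blast
next
  case (add f g)
  then obtain F G where "\<And>x. \<bar>f x\<bar> \<le> F" "\<And>x. \<bar>g x\<bar> \<le> G" by blast
  then have "\<bar>f x + g x\<bar> \<le> F + G" for x using abs_triangle_ineq add_mono order_trans by blast
  then show ?case by blast
qed

lemma trig_poly_polynomial:
  fixes q :: "real \<Rightarrow> real"
  assumes "real_polynomial_function q" "trig_poly p"
  shows "trig_poly (\<lambda>x. q (p x))"
  using assms(1)
proof (induct q rule: real_polynomial_function.induct)
  case (linear f)
  have "f t = t * f 1" for t
    using linear_scale[OF bounded_linear.linear[OF linear], of t 1] by simp
  then have "(\<lambda>x. f (p x)) = (\<lambda>x. p x * f 1)" by blast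
  then show ?case using trig_poly_mult[OF assms(2) trig_poly_const[of "f 1"]] by simp
qed (auto intro: trig_poly_const trig_poly.add trig_poly_mult)

lemma trig_poly_separates:
  fixes x y :: "'a::real_inner"
  assumes "x \<noteq> y"
  shows "\<exists>f. trig_poly f \<and> f x \<noteq> f y"
proof -
  \<comment> \<open>Normalised so that the phases at \<open>x\<close> and \<open>y\<close> differ by
    exactly 1, which lies between 0 and pi, where cosine is strictly decreasing.\<close>
  define u where "u = (1 / (norm (x - y))\<^sup>2) *\<^sub>R (x - y)"
  have "u \<bullet> (x - y) = 1"
    using assms by (simp add: u_def power2_norm_eq_inner)
  then have u: "u \<bullet> x = u \<bullet> y + 1" by (simp add: inner_diff_right)
  have "cos (u \<bullet> x + (- (u \<bullet> y))) \<noteq> cos (u \<bullet> y + (- (u \<bullet> y)))"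
    using cos_monotone_0_pi[of 0 1] pi_gt3 by (simp add: u)
  moreover have "trig_poly (\<lambda>x. cos (u \<bullet> x + (- (u \<bullet> y))))"
    using trig_poly.cos[of 1 u "- (u \<bullet> y)"] by simp
  ultimately show ?thesis by blast
qed

text \<open>A trigonometric approximation on a ball may be large elsewhere; composing it with a polynomial close to
  the truncation at level \<open>B\<close> makes it globally bounded.\<close>

lemma trig_poly_approx:
  fixes f :: "'a::euclidean_space \<Rightarrow> real"
  assumes f: "continuous_on UNIV f" "\<And>x. \<bar>f x\<bar> \<le> B" and e: "e > 0"
  obtains g where "trig_poly g" "\<And>x. norm x \<le> R \<Longrightarrow> \<bar>f x - g x\<bar> \<le> e" "\<And>x. \<bar>g x\<bar> \<le> B + e"
proof -
  have B: "B \<ge> 0" using f(2) abs_ge_zero order_trans by blast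
  have "\<exists>p. trig_poly p \<and> (\<forall>x\<in>cball 0 R. \<bar>f x - p x\<bar> < e / 2)"
  proof (rule Stone_Weierstrass_HOL[where P = trig_poly])
    show "continuous_on (cball 0 R) f" using f(1) continuous_on_subset by blast
  qed (use e in \<open>auto intro: trig_poly_const trig_poly_continuous trig_poly.add trig_poly_mult trig_poly_separates\<close>)
  then obtain p where p: "trig_poly p" "\<And>x. norm x \<le> R \<Longrightarrow> \<bar>f x - p x\<bar> < e / 2" by auto
  obtain G where G: "\<And>x. \<bar>p x\<bar> \<le> G" using trig_poly_bounded[OF p(1)] by blast
  define clip where "clip t = max (- B) (min B t)" for t :: real
  have "continuous_on {-G..G} clip" unfolding clip_def by (intro continuous_intros)
  then obtain q where q: "real_polynomial_function q" "\<And>t. t \<in> {-G..G} \<Longrightarrow> \<bar>clip t - q t\<bar> < e / 2"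
    using Stone_Weierstrass_real_polynomial_function[of "{-G..G}" clip "e / 2"] e by auto
  have qp: "\<bar>clip (p x) - q (p x)\<bar> < e / 2" for x using q(2) G[of x] by (auto simp: abs_le_iff)
  show ?thesis
  proof
    show "trig_poly (\<lambda>x. q (p x))" by (rule trig_poly_polynomial[OF q(1) p(1)])
    fix x
    have "\<bar>clip (p x)\<bar> \<le> B" using B by (auto simp: clip_def)
    then show "\<bar>q (p x)\<bar> \<le> B + e" using qp[of x] e by linarith
    assume "norm x \<le> R"
    then have "\<bar>f x - p x\<bar> < e / 2" by (rule p(2))
    \<comment> \<open>Values of \<open>f\<close> lie in \<open>[-B, B]\<close> and
      \<open>clip\<close> is the projection onto this interval, so clipping cannot increase the
      error.\<close>
    moreover have "\<bar>f x - clip (p x)\<bar> \<le> \<bar>f x - p x\<bar>"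
      using f(2)[of x] by (auto simp: clip_def max_def min_def)
    ultimately show "\<bar>f x - q (p x)\<bar> \<le> e" using qp[of x] by linarith
  qed
qed

text \<open>The recurring split: an error \<open>e\<close> everywhere, plus an error of size
  \<open>c\<close> confined to an exceptional event \<open>A\<close>.\<close>

lemma (in prob_space) expectation_diff_le:
  fixes f g :: "'a \<Rightarrow> real"
  assumes [measurable]: "integrable M f" "integrable M g" "A \<in> events"
    and le: "AE x in M. \<bar>f x - g x\<bar> \<le> e + c * indicator A x"
  shows "\<bar>expectation f - expectation g\<bar> \<le> e + c * prob A"
proof -
  have int: "integrable M (\<lambda>x. e + c * indicator A x)"
    by (intro Bochner_Integration.integrable_add integrable_mult_right integrable_real_indicator) (auto simp: emeasure_eq_measure)
  have "\<bar>expectation f - expectation g\<bar> = \<bar>expectation (\<lambda>x. f x - g x)\<bar>" using assms by simp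
  also have "\<dots> \<le> expectation (\<lambda>x. \<bar>f x - g x\<bar>)" by (rule integral_abs_bound)
  also have "\<dots> \<le> expectation (\<lambda>x. e + c * indicator A x)"
    using assms by (intro integral_mono_AE int) auto
  also have "\<dots> = e + c * prob A"
    by (subst Bochner_Integration.integral_add) (auto simp: prob_space emeasure_eq_measure)
  finally show ?thesis .
qed

text \<open>A trigonometric \<open>g\<close> close to \<open>f\<close> on a large ball splits the
  difference into three parts: \<open>f\<close> against \<open>g\<close> under each of the two
  measures, small by tightness, and the two integrals of \<open>g\<close>, close by convergence of
  characteristic functions.\<close>

lemma weakly_converges_from_char:
  fixes \<mu> :: "nat \<Rightarrow> 'b::euclidean_space measure" and \<nu> :: "'b measure"
  assumes \<mu>: "\<And>n. prob_space (\<mu> n)" "\<And>n. sets (\<mu> n) = sets borel"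
    and \<nu>: "prob_space \<nu>" "sets \<nu> = sets borel"
    and char: "\<And>u. (\<lambda>n. \<integral>x. iexp (u \<bullet> x) \<partial>\<mu> n) \<longlonglongrightarrow> (\<integral>x. iexp (u \<bullet> x) \<partial>\<nu>)"
    and tight: "\<And>e. e > 0 \<Longrightarrow> \<exists>R. \<forall>n. measure (\<mu> n) {x. norm x > R} \<le> e"
  shows "weakly_converges \<mu> \<nu>"
  unfolding weakly_converges_def
proof (intro allI impI, elim conjE)
  have int_bdd: "integrable N f" if "prob_space N" "sets N = sets borel" "continuous_on UNIV f" "\<And>x. norm (f x) \<le> C"
    for N and f :: "'b \<Rightarrow> 'c::{banach,second_countable_topology}" and C
  proof -
    interpret prob_space N by fact
    have "f \<in> borel_measurable N"
      using borel_measurable_continuous_onI[OF that(3)] measurable_cong_sets[OF that(2) refl] by blast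
    then show ?thesis using that(4) by (intro integrable_const_bound[of _ C]) auto
  qed
  have int_trig: "integrable N g" if "prob_space N" "sets N = sets borel" "trig_poly g" for N and g :: "'b \<Rightarrow> real"
    using trig_poly_bounded[OF that(3)] int_bdd[OF that(1,2) trig_poly_continuous[OF that(3)]] by auto
  have trig: "(\<lambda>n. \<integral>x. g x \<partial>\<mu> n) \<longlonglongrightarrow> (\<integral>x. g x \<partial>\<nu>)" if "trig_poly g" for g :: "'b \<Rightarrow> real"
    using that
  proof (induct g rule: trig_poly.induct)
    case (cos a u b)
    have eq: "(\<integral>x. a * cos (u \<bullet> x + b) \<partial>N) = a * Re (iexp b * (\<integral>x. iexp (u \<bullet> x) \<partial>N))"
      if "prob_space N" "sets N = sets borel" for N
    proof -
      have int: "integrable N (\<lambda>x. iexp b * iexp (u \<bullet> x))"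
        using that by (rule int_bdd[of _ _ 1]) (auto intro!: continuous_intros simp: norm_mult)
      \<comment> \<open>A phase shift is multiplication of the character by a constant of modulus 1,
        so every generator reduces to the characteristic function at \<open>u\<close>.\<close>
      have "cos (u \<bullet> x + b) = Re (iexp b * iexp (u \<bullet> x))" for x
        by (simp add: exp_add[symmetric] Re_exp add.commute flip: distrib_left)
      then have "(\<integral>x. a * cos (u \<bullet> x + b) \<partial>N) = a * (\<integral>x. Re (iexp b * iexp (u \<bullet> x)) \<partial>N)"
        by (simp only: integral_mult_right_zero)
      also have "\<dots> = a * Re (\<integral>x. iexp b * iexp (u \<bullet> x) \<partial>N)"
        using int by (simp only: integral_Re)
      finally show ?thesis by simp
    qed
    show ?case
      unfolding eq[OF \<mu>] eq[OF \<nu>] by (intro tendsto_intros char)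
  next
    case (add f g)
    then show ?case by (simp add: int_trig[OF \<mu>] int_trig[OF \<nu>] tendsto_add)
  qed
  fix f :: "'b \<Rightarrow> real"
  assume f: "continuous_on UNIV f" "bounded (range f)"
  obtain B where B: "\<And>x. \<bar>f x\<bar> \<le> B"
    using f(2) unfolding bounded_iff by auto
  have B0: "B \<ge> 0" using B abs_ge_zero order_trans by blast
  show "(\<lambda>n. \<integral>x. f x \<partial>\<mu> n) \<longlonglongrightarrow> (\<integral>x. f x \<partial>\<nu>)"
  proof (rule LIMSEQ_I)
    fix r :: real assume r: "r > 0"
    \<comment> \<open>With \<open>e \<le> 1\<close> the difference \<open>f - g\<close> is at most
      \<open>2 * B + 1\<close> off the ball, so each replacement of \<open>f\<close> by
      \<open>g\<close> costs at most \<open>e * (2 * B + 3)\<close>; two replacements may use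
      \<open>r / 2\<close>.\<close>
    define e where "e = min 1 (r / (2 * (2 * B + 3)) / 2)"
    have e: "e > 0" "e \<le> 1" using r B0 by (auto simp: e_def)
    have er: "2 * (e * (2 * B + 3)) \<le> r / 2"
    proof -
      have "e \<le> r / (2 * (2 * B + 3)) / 2" by (simp add: e_def)
      then show ?thesis using B0 by (simp add: field_simps)
    qed
    obtain R1 where R1: "\<And>n. measure (\<mu> n) {x. norm x > R1} \<le> e" using tight[OF e(1)] by blast
    obtain R2 where R2: "measure \<nu> {x. norm x > R2} \<le> e"
    proof -
      interpret \<nu>: prob_space \<nu> by fact
      have "(\<lambda>k. measure \<nu> {x. norm x > real k}) \<longlonglongrightarrow> measure \<nu> (\<Inter>k. {x. norm x > real k})"
        by (rule \<nu>.finite_Lim_measure_decseq) (auto simp: decseq_def \<nu>)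
      moreover have "(\<Inter>k. {x::'b. norm x > real k}) = {}"
        by (auto simp: set_eq_iff) (meson less_asym reals_Archimedean2)
      ultimately have "(\<lambda>k. measure \<nu> {x. norm x > real k}) \<longlonglongrightarrow> 0" by simp
      then have "\<forall>\<^sub>F k in sequentially. measure \<nu> {x. norm x > real k} < e"
        using e(1) by (rule order_tendstoD(2))
      then show ?thesis using that by (auto simp: eventually_sequentially intro: less_imp_le)
    qed
    define R where "R = max R1 R2"
    obtain g where g: "trig_poly g" "\<And>x. norm x \<le> R \<Longrightarrow> \<bar>f x - g x\<bar> \<le> e" "\<And>x. \<bar>g x\<bar> \<le> B + e"
      using trig_poly_approx[OF f(1) B e(1)] by blast
    \<comment> \<open>Stated for an arbitrary \<open>N\<close> to serve both \<open>\<mu> n\<close>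
      and \<open>\<nu>\<close>; their separate radii are covered by the common
      \<open>R\<close>.\<close>
    have *: "\<bar>(\<integral>x. f x \<partial>N) - (\<integral>x. g x \<partial>N)\<bar> \<le> e * (2 * B + 3)"
      if N: "prob_space N" "sets N = sets borel" and R': "measure N {x. norm x > R'} \<le> e" "R' \<le> R" for N R'
    proof -
      interpret prob_space N by fact
      have [measurable]: "{x. norm x > R'} \<in> sets N" "{x. norm x > R} \<in> sets N" by (auto simp: N)
      have diff: "\<bar>(\<integral>x. f x \<partial>N) - (\<integral>x. g x \<partial>N)\<bar> \<le> e + (2 * B + 1) * measure N {x. norm x > R}"
      proof (rule expectation_diff_le)
        show "AE x in N. \<bar>f x - g x\<bar> \<le> e + (2 * B + 1) * indicator {x. norm x > R} x"
        proof (intro AE_I2)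
          fix x show "\<bar>f x - g x\<bar> \<le> e + (2 * B + 1) * indicator {x. norm x > R} x"
          proof (cases "norm x \<le> R")
            case True then show ?thesis using g(2) by simp
          next
            case False then show ?thesis
              using B[of x] g(3)[of x] e by (simp add: indicator_def)
          qed
        qed
      qed (use int_bdd[OF N f(1)] B int_trig[OF N g(1)] in auto)
      have "measure N {x. norm x > R} \<le> measure N {x. norm x > R'}"
        using R'(2) by (intro finite_measure_mono) auto
      also have "\<dots> \<le> e" by (rule R')
      finally have "(2 * B + 1) * measure N {x. norm x > R} \<le> (2 * B + 1) * e"
        using B0 by (intro mult_left_mono) auto
      with diff show ?thesis using e(1) by (simp add: algebra_simps)
    qed
    have "\<forall>\<^sub>F n in sequentially. \<bar>(\<integral>x. g x \<partial>\<mu> n) - (\<integral>x. g x \<partial>\<nu>)\<bar> < r / 2"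
      using tendstoD[OF trig[OF g(1)], of "r / 2"] r by (simp add: dist_real_def)
    then obtain n0 where n0: "\<And>n. n \<ge> n0 \<Longrightarrow> \<bar>(\<integral>x. g x \<partial>\<mu> n) - (\<integral>x. g x \<partial>\<nu>)\<bar> < r / 2"
      unfolding eventually_sequentially by blast
    show "\<exists>n0. \<forall>n\<ge>n0. norm ((\<integral>x. f x \<partial>\<mu> n) - (\<integral>x. f x \<partial>\<nu>)) < r"
    proof (intro exI allI impI)
      fix n assume "n \<ge> n0"
      have tri: "\<bar>a - d\<bar> < r" if "\<bar>b - c\<bar> < r / 2" "\<bar>a - b\<bar> \<le> k" "\<bar>d - c\<bar> \<le> k" "2 * k \<le> r / 2"
        for a b c d k :: real
        using that by linarith
      show "norm ((\<integral>x. f x \<partial>\<mu> n) - (\<integral>x. f x \<partial>\<nu>)) < r"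
        unfolding real_norm_def
        by (rule tri[OF n0[OF \<open>n \<ge> n0\<close>] *[OF \<mu> R1] *[OF \<nu> R2] er]) (auto simp: R_def)
    qed
  qed
qed

section \<open>The isotropic normal distribution\<close>

lemma lborel_integral_prod_Basis:
  fixes f :: "'a::euclidean_space \<Rightarrow> real \<Rightarrow> complex"
  assumes "\<And>b. b \<in> Basis \<Longrightarrow> integrable lborel (f b)"
  shows "(\<integral>x. (\<Prod>b\<in>Basis. f b (x \<bullet> b)) \<partial>lborel) = (\<Prod>b\<in>Basis. \<integral>y. f b y \<partial>lborel)"
proof -
  interpret product_sigma_finite "\<lambda>_::'a. lborel :: real measure" by standard
  have [measurable]: "b \<in> Basis \<Longrightarrow> f b \<in> borel_measurable borel" for b
    using borel_measurable_integrable[OF assms] by simp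
  have "(\<integral>x. (\<Prod>b\<in>Basis. f b (x \<bullet> b)) \<partial>lborel) =
      (\<integral>y. (\<Prod>b\<in>Basis. f b ((\<Sum>c\<in>Basis. y c *\<^sub>R c) \<bullet> b)) \<partial>(\<Pi>\<^sub>M b\<in>(Basis::'a set). lborel))"
    by (subst lborel_eq, subst integral_distr) (auto intro!: borel_measurable_prod)
  also have "\<dots> = (\<integral>y. (\<Prod>b\<in>Basis. f b (y b)) \<partial>(\<Pi>\<^sub>M b\<in>(Basis::'a set). lborel))"
    by (simp add: inner_sum_left_Basis cong: prod.cong)
  also have "\<dots> = (\<Prod>b\<in>Basis. \<integral>y. f b y \<partial>lborel)"
    by (rule product_integral_prod) (auto intro: assms)
  finally show ?thesis .
qed

text \<open>The substitution of \<open>\<sigma> * y\<close> for \<open>y\<close> reduces the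
  integral to the standard normal characteristic function at \<open>t * \<sigma>\<close>.\<close>

lemma integral_normal_density_iexp:
  assumes \<sigma>: "\<sigma> > 0"
  shows "integrable lborel (\<lambda>y. normal_density 0 \<sigma> y *\<^sub>R iexp (t * y))"
    and "(\<integral>y. normal_density 0 \<sigma> y *\<^sub>R iexp (t * y) \<partial>lborel) = exp (- (\<sigma>\<^sup>2 * t\<^sup>2) / 2)"
proof -
  show "integrable lborel (\<lambda>y. normal_density 0 \<sigma> y *\<^sub>R iexp (t * y))"
    using integrable_normal_density[OF \<sigma>, of 0]
    by (rule Bochner_Integration.integrable_bound) (auto simp: norm_mult)
  have std: "\<sigma> * normal_density 0 \<sigma> (\<sigma> * y) = std_normal_density y" for y
    using \<sigma> by (simp add: normal_density_def real_sqrt_mult power_mult_distrib)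
  have "(\<integral>y. normal_density 0 \<sigma> y *\<^sub>R iexp (t * y) \<partial>lborel) =
      \<bar>\<sigma>\<bar> *\<^sub>R (\<integral>y. normal_density 0 \<sigma> (0 + \<sigma> * y) *\<^sub>R iexp (t * (0 + \<sigma> * y)) \<partial>lborel)"
    using \<sigma> by (intro lborel_integral_real_affine) simp
  also have "\<dots> = (\<integral>y. (\<sigma> * normal_density 0 \<sigma> (\<sigma> * y)) *\<^sub>R iexp ((t * \<sigma>) * y) \<partial>lborel)"
    using \<sigma> by (simp add: mult.assoc flip: integral_scaleR_right)
  also have "\<dots> = char std_normal_distribution (t * \<sigma>)"
    unfolding std char_def by (subst integral_density) auto
  also have "\<dots> = exp (- (\<sigma>\<^sup>2 * t\<^sup>2) / 2)"
    by (simp add: char_std_normal_distribution power_mult_distrib mult.commute)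
  finally show "(\<integral>y. normal_density 0 \<sigma> y *\<^sub>R iexp (t * y) \<partial>lborel) = exp (- (\<sigma>\<^sup>2 * t\<^sup>2) / 2)" .
qed

text \<open>In product form both the total mass and the characteristic function factor into
  one-dimensional integrals.\<close>

lemma multivariate_normal_isotropic:
  assumes \<sigma>: "\<sigma> > 0"
  shows "multivariate_normal 0 (\<sigma>\<^sup>2 *\<^sub>R mat 1 :: real ^ 'd ^ 'd) =
    density lborel (\<lambda>x. ennreal (\<Prod>b\<in>Basis. normal_density 0 \<sigma> (x \<bullet> b)))"
proof -
  have "(\<sigma>\<^sup>2 *\<^sub>R mat 1) ** ((1 / \<sigma>\<^sup>2) *\<^sub>R mat 1) = (mat 1 :: real ^ 'd ^ 'd)"
    using \<sigma> by (simp add: matrix_eq flip: matrix_vector_mul_assoc scaleR_matrix_vector_assoc)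
  then have inv: "matrix_inv (\<sigma>\<^sup>2 *\<^sub>R mat 1 :: real ^ 'd ^ 'd) = (1 / \<sigma>\<^sup>2) *\<^sub>R mat 1"
    by (rule matrix_inv_eqI)
  have det: "det (\<sigma>\<^sup>2 *\<^sub>R mat 1 :: real ^ 'd ^ 'd) = (\<sigma>\<^sup>2) ^ CARD('d)"
    by (subst det_diagonal) (auto simp: mat_def)
  have "exp (- ((x - 0) \<bullet> (matrix_inv (\<sigma>\<^sup>2 *\<^sub>R mat 1 :: real ^ 'd ^ 'd) *v (x - 0))) / 2)
      / sqrt ((2 * pi) ^ CARD('d) * det (\<sigma>\<^sup>2 *\<^sub>R mat 1 :: real ^ 'd ^ 'd))
    = (\<Prod>b\<in>Basis. normal_density 0 \<sigma> (x \<bullet> b))" for x :: "real ^ 'd"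
  proof -
    have "(\<Prod>b\<in>Basis. normal_density 0 \<sigma> (x \<bullet> b)) =
        (1 / sqrt (2 * pi * \<sigma>\<^sup>2)) ^ CARD('d) * exp (\<Sum>b\<in>Basis. - (x \<bullet> b)\<^sup>2 / (2 * \<sigma>\<^sup>2))"
      by (simp add: normal_density_def prod.distrib exp_sum prod_dividef power_one_over)
    also have "(\<Sum>b\<in>Basis. - (x \<bullet> b)\<^sup>2 / (2 * \<sigma>\<^sup>2)) = - (x \<bullet> x) / (2 * \<sigma>\<^sup>2)"
      unfolding euclidean_inner[of x x] power2_eq_square by (simp only: sum_negf[symmetric] sum_divide_distrib)
    also have "- (x \<bullet> x) / (2 * \<sigma>\<^sup>2) = - (x \<bullet> x / \<sigma>\<^sup>2) / 2" by simp
    also have "x \<bullet> x / \<sigma>\<^sup>2 = (x - 0) \<bullet> (matrix_inv (\<sigma>\<^sup>2 *\<^sub>R mat 1 :: real ^ 'd ^ 'd) *v (x - 0))"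
      by (simp add: inv flip: scaleR_matrix_vector_assoc)
    also have "(1 / sqrt (2 * pi * \<sigma>\<^sup>2)) ^ CARD('d) = 1 / sqrt ((2 * pi) ^ CARD('d) * det (\<sigma>\<^sup>2 *\<^sub>R mat 1 :: real ^ 'd ^ 'd))"
      by (simp only: det power_mult_distrib[symmetric] real_sqrt_power power_one_over)
    finally show ?thesis by simp
  qed
  then show ?thesis unfolding multivariate_normal_def by presburger
qed

lemma prob_space_multivariate_normal_isotropic:
  assumes \<sigma>: "\<sigma> > 0"
  shows "prob_space (multivariate_normal 0 (\<sigma>\<^sup>2 *\<^sub>R mat 1 :: real ^ 'd ^ 'd))"
proof
  have "emeasure (density lborel (normal_density 0 \<sigma>)) UNIV = 1"
    using prob_space.emeasure_space_1[OF prob_space_normal_density[OF \<sigma>, of 0]] by simp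
  then have 1: "(\<integral>\<^sup>+y. ennreal (normal_density 0 \<sigma> y) \<partial>lborel) = 1"
    by (simp add: emeasure_density)
  have "emeasure (density lborel (\<lambda>x::real^'d. ennreal (\<Prod>b\<in>Basis. normal_density 0 \<sigma> (x \<bullet> b)))) UNIV
     = (\<integral>\<^sup>+x. (\<Prod>b\<in>(Basis::(real^'d) set). ennreal (normal_density 0 \<sigma> (x \<bullet> b))) \<partial>lborel)"
    by (simp add: emeasure_density prod_ennreal)
  also have "\<dots> = (\<Prod>b\<in>(Basis::(real^'d) set). \<integral>\<^sup>+y. ennreal (normal_density 0 \<sigma> y) \<partial>lborel)"
    by (rule nn_integral_lborel_prod) auto
  finally show "emeasure (multivariate_normal 0 (\<sigma>\<^sup>2 *\<^sub>R mat 1 :: real ^ 'd ^ 'd))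
      (space (multivariate_normal 0 (\<sigma>\<^sup>2 *\<^sub>R mat 1 :: real ^ 'd ^ 'd))) = 1"
    using 1 by (simp add: multivariate_normal_isotropic[OF \<sigma>])
qed

lemma sets_multivariate_normal: "sets (multivariate_normal m S) = sets borel"
  by (simp add: multivariate_normal_def)

lemma char_multivariate_normal_isotropic:
  fixes u :: "real ^ 'd"
  assumes \<sigma>: "\<sigma> > 0"
  shows "(\<integral>x. iexp (u \<bullet> x) \<partial>multivariate_normal 0 (\<sigma>\<^sup>2 *\<^sub>R mat 1)) = exp (- (\<sigma>\<^sup>2 * (norm u)\<^sup>2) / 2)"
proof -
  have "(\<integral>x. iexp (u \<bullet> x) \<partial>multivariate_normal 0 (\<sigma>\<^sup>2 *\<^sub>R mat 1)) =
      (\<integral>x. (\<Prod>b\<in>Basis. normal_density 0 \<sigma> (x \<bullet> b)) *\<^sub>R iexp (u \<bullet> x) \<partial>lborel)"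
    unfolding multivariate_normal_isotropic[OF \<sigma>]
    by (subst integral_density) (auto intro!: prod_nonneg)
  also have "\<dots> = (\<integral>x. (\<Prod>b\<in>Basis. normal_density 0 \<sigma> (x \<bullet> b) *\<^sub>R iexp ((u \<bullet> b) * (x \<bullet> b))) \<partial>lborel)"
  proof (intro Bochner_Integration.integral_cong refl)
    fix x :: "real ^ 'd"
    have "iexp (u \<bullet> x) = (\<Prod>b\<in>Basis. iexp ((u \<bullet> b) * (x \<bullet> b)))"
      by (subst euclidean_inner) (simp add: exp_sum[symmetric] sum_distrib_left)
    then show "(\<Prod>b\<in>Basis. normal_density 0 \<sigma> (x \<bullet> b)) *\<^sub>R iexp (u \<bullet> x) =
        (\<Prod>b\<in>Basis. normal_density 0 \<sigma> (x \<bullet> b) *\<^sub>R iexp ((u \<bullet> b) * (x \<bullet> b)))"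
      by (simp add: scaleR_conv_of_real prod.distrib)
  qed
  also have "\<dots> = (\<Prod>b\<in>(Basis::(real^'d) set). complex_of_real (exp (- (\<sigma>\<^sup>2 * (u \<bullet> b)\<^sup>2) / 2)))"
    by (subst lborel_integral_prod_Basis[OF integral_normal_density_iexp(1)[OF \<sigma>]])
      (simp only: integral_normal_density_iexp(2)[OF \<sigma>])
  also have "\<dots> = complex_of_real (exp (\<Sum>b\<in>(Basis::(real^'d) set). - (\<sigma>\<^sup>2 * (u \<bullet> b)\<^sup>2) / 2))"
    by (simp add: exp_sum)
  also have "(\<Sum>b\<in>(Basis::(real^'d) set). - (\<sigma>\<^sup>2 * (u \<bullet> b)\<^sup>2) / 2) = - (\<sigma>\<^sup>2 * (norm u)\<^sup>2) / 2"
    unfolding power2_norm_eq_inner euclidean_inner[of u u]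
    by (simp add: sum_negf sum_divide_distrib sum_distrib_left power2_eq_square)
  finally show ?thesis .
qed


section \<open>A central limit theorem for predictably weighted noise\<close>

text \<open>The first bound interpolates between the cubic remainder, better for
  \<open>|z| \<le> 1\<close>, and the quadratic one, better beyond. The quadratic bound later
  supplies integrability, since the noise has a second moment.\<close>

lemma iexp_second_order:
  fixes z \<kappa> :: real
  assumes \<kappa>: "0 < \<kappa>" "\<kappa> \<le> 1"
  shows "cmod (iexp z - (1 + \<i> * z - z\<^sup>2 / 2)) \<le> \<bar>z\<bar> powr (2 + \<kappa>)"
    and "cmod (iexp z - (1 + \<i> * z - z\<^sup>2 / 2)) \<le> z\<^sup>2"
proof -
  have sum: "(\<Sum>k\<le>2. (\<i> * complex_of_real z) ^ k / fact k) = 1 + \<i> * z - z\<^sup>2 / 2"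
    by (simp add: numeral_2_eq_2 power2_eq_square algebra_simps)
  have 1: "cmod (iexp z - (1 + \<i> * z - z\<^sup>2 / 2)) \<le> \<bar>z\<bar> ^ 3"
  proof -
    have "\<bar>z\<bar> ^ Suc 2 / fact (Suc 2) = \<bar>z\<bar> ^ 3 / 6" by (simp add: fact_numeral)
    moreover have "0 \<le> \<bar>z\<bar> ^ 3" by simp
    ultimately show ?thesis using iexp_approx1[of z 2] unfolding sum by linarith
  qed
  show 2: "cmod (iexp z - (1 + \<i> * z - z\<^sup>2 / 2)) \<le> z\<^sup>2"
    using iexp_approx2[of z 2] unfolding sum by (simp add: fact_numeral)
  show "cmod (iexp z - (1 + \<i> * z - z\<^sup>2 / 2)) \<le> \<bar>z\<bar> powr (2 + \<kappa>)"
  proof (cases "\<bar>z\<bar> \<le> 1")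
    case True
    have "\<bar>z\<bar> ^ 3 \<le> \<bar>z\<bar> powr (2 + \<kappa>)"
    proof (cases "z = 0")
      case False
      then have "\<bar>z\<bar> ^ 3 = \<bar>z\<bar> powr 3" by (simp add: powr_numeral)
      also have "\<dots> \<le> \<bar>z\<bar> powr (2 + \<kappa>)" using True \<kappa> by (intro powr_mono') auto
      finally show ?thesis .
    qed simp
    with 1 show ?thesis by linarith
  next
    case False
    then have "z\<^sup>2 = \<bar>z\<bar> powr 2" by (simp add: powr_numeral)
    also have "\<dots> \<le> \<bar>z\<bar> powr (2 + \<kappa>)" using False \<kappa> by (intro powr_mono) auto
    finally show ?thesis using 2 by linarith
  qed
qed

lemma exp_minus_second_order:
  fixes y :: real
  assumes "0 \<le> y"
  shows "\<bar>exp (- y) - (1 - y)\<bar> \<le> y\<^sup>2 / 2"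
proof -
  have "exp (- y) \<le> 1 - y + y\<^sup>2 / 2"
  proof -
    have d: "DERIV (\<lambda>y. 1 - y + y\<^sup>2 / 2 - exp (- y)) x :> x - 1 + exp (- x)" for x :: real
      by (auto intro!: derivative_eq_intros)
    have "0 \<le> x - 1 + exp (- x)" for x :: real
      using exp_ge_add_one_self[of "- x"] by simp
    with d have "\<exists>z. DERIV (\<lambda>y. 1 - y + y\<^sup>2 / 2 - exp (- y)) x :> z \<and> 0 \<le> z" for x :: real
      by blast
    from DERIV_nonneg_imp_nondecreasing[OF assms this]
    have "1 - 0 + 0\<^sup>2 / 2 - exp (- 0) \<le> 1 - y + y\<^sup>2 / 2 - exp (- y)" .
    then show ?thesis by simp
  qed
  moreover have "1 - y \<le> exp (- y)" using exp_ge_add_one_self[of "- y"] by simp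
  ultimately show ?thesis by linarith
qed

text \<open>Bounded convergence under convergence in probability; it is applied to the error of the
  compensator and to the Taylor error rate.\<close>

lemma (in prob_space) expectation_tendsto_zero_in_prob:
  fixes X :: "nat \<Rightarrow> 'a \<Rightarrow> real" and g :: "real \<Rightarrow> real"
  assumes [measurable]: "\<And>n. X n \<in> borel_measurable M" "g \<in> borel_measurable borel"
    and X: "tendsto_zero_in_prob M X"
    and g: "\<And>e. e > 0 \<Longrightarrow> \<exists>d>0. \<forall>x. \<bar>x\<bar> \<le> d \<longrightarrow> \<bar>g x\<bar> \<le> e"
    and bound: "\<And>n \<omega>. \<omega> \<in> space M \<Longrightarrow> \<bar>g (X n \<omega>)\<bar> \<le> B"
  shows "(\<lambda>n. expectation (\<lambda>\<omega>. \<bar>g (X n \<omega>)\<bar>)) \<longlonglongrightarrow> 0"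
proof (rule LIMSEQ_I)
  fix r :: real assume r: "r > 0"
  obtain \<omega>0 where "\<omega>0 \<in> space M" using not_empty by blast
  then have B: "B \<ge> 0" using bound[of \<omega>0 0] by linarith
  obtain d where d: "d > 0" "\<And>x. \<bar>x\<bar> \<le> d \<Longrightarrow> \<bar>g x\<bar> \<le> r / 2" using g[of "r / 2"] r by auto
  have "(\<lambda>n. r / 2 + B * prob {\<omega> \<in> space M. \<bar>X n \<omega>\<bar> > d}) \<longlonglongrightarrow> r / 2 + B * 0"
    using X d(1) unfolding tendsto_zero_in_prob_def by (intro tendsto_intros) auto
  then have "\<forall>\<^sub>F n in sequentially. r / 2 + B * prob {\<omega> \<in> space M. \<bar>X n \<omega>\<bar> > d} < r"
    by (rule order_tendstoD(2)) (use r in simp)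
  moreover have "expectation (\<lambda>\<omega>. \<bar>g (X n \<omega>)\<bar>) \<le> r / 2 + B * prob {\<omega> \<in> space M. \<bar>X n \<omega>\<bar> > d}" for n
  proof -
    have "\<bar>expectation (\<lambda>\<omega>. \<bar>g (X n \<omega>)\<bar>) - expectation (\<lambda>\<omega>. 0)\<bar>
        \<le> r / 2 + B * prob {\<omega> \<in> space M. \<bar>X n \<omega>\<bar> > d}"
    proof (rule expectation_diff_le)
      show "integrable M (\<lambda>\<omega>. \<bar>g (X n \<omega>)\<bar>)"
        using bound by (intro integrable_const_bound[of _ B]) auto
      show "AE \<omega> in M. \<bar>\<bar>g (X n \<omega>)\<bar> - 0\<bar> \<le> r / 2 + B * indicator {\<omega> \<in> space M. \<bar>X n \<omega>\<bar> > d} \<omega>"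
        using bound d(2) r B by (intro AE_I2) (auto simp: indicator_def not_less intro: add_increasing)
    qed auto
    then show ?thesis by simp
  qed
  moreover have "0 \<le> expectation (\<lambda>\<omega>. \<bar>g (X n \<omega>)\<bar>)" for n by simp
  ultimately have "\<forall>\<^sub>F n in sequentially. norm (expectation (\<lambda>\<omega>. \<bar>g (X n \<omega>)\<bar>) - 0) < r"
    by (elim eventually_mono) (auto intro: order_le_less_trans)
  then show "\<exists>n0. \<forall>n\<ge>n0. norm (expectation (\<lambda>\<omega>. \<bar>g (X n \<omega>)\<bar>) - 0) < r"
    unfolding eventually_sequentially .
qed

text \<open>The conditional expectation is real-valued while the multiplier is a complex
  exponential, so real and imaginary parts are treated separately.\<close>

lemma (in prob_space) expectation_mult_const_cond_exp:
  fixes H :: "'a \<Rightarrow> complex" and X :: "'a \<Rightarrow> real"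
  assumes G: "subalgebra M G" and X: "integrable M X" "AE \<omega> in M. real_cond_exp M G X \<omega> = c"
    and H: "H \<in> borel_measurable G" "\<And>\<omega>. \<omega> \<in> space M \<Longrightarrow> cmod (H \<omega>) \<le> C"
  shows "integrable M (\<lambda>\<omega>. H \<omega> * X \<omega>)" "expectation (\<lambda>\<omega>. H \<omega> * X \<omega>) = c * expectation H"
proof -
  interpret G: finite_measure_subalgebra M G by unfold_locales (rule G)
  have [measurable]: "X \<in> borel_measurable M" using X(1) by auto
  have [measurable]: "H \<in> borel_measurable M" using measurable_from_subalg[OF G H(1)] .
  have C: "0 \<le> C" using not_empty H(2) norm_ge_zero order_trans by blast
  have bnd: "norm (H \<omega> * X \<omega>) \<le> norm (C * X \<omega>)" if "\<omega> \<in> space M" for \<omega>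
    using H(2)[OF that] C by (simp add: norm_mult abs_mult mult_right_mono)
  have intC: "integrable M (\<lambda>\<omega>. C * X \<omega>)" using X(1) by simp
  show int: "integrable M (\<lambda>\<omega>. H \<omega> * X \<omega>)"
    using intC by (rule Bochner_Integration.integrable_bound) (use bnd in \<open>auto intro!: AE_I2\<close>)
  have intH: "integrable M H" using H(2) by (intro integrable_const_bound[of _ C]) auto
  have real: "expectation (\<lambda>\<omega>. h \<omega> * X \<omega>) = c * expectation h"
    if h: "h \<in> borel_measurable G" "\<And>\<omega>. \<omega> \<in> space M \<Longrightarrow> \<bar>h \<omega>\<bar> \<le> C" for h
  proof -
    have [measurable]: "h \<in> borel_measurable M" using measurable_from_subalg[OF G h(1)] .
    have "integrable M (\<lambda>\<omega>. h \<omega> * X \<omega>)"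
      using intC by (rule Bochner_Integration.integrable_bound)
        (use h(2) C in \<open>auto intro!: AE_I2 mult_right_mono simp: abs_mult\<close>)
    then have "expectation (\<lambda>\<omega>. h \<omega> * X \<omega>) = expectation (\<lambda>\<omega>. h \<omega> * real_cond_exp M G X \<omega>)"
      using G.real_cond_exp_intg(2)[OF _ h(1)] by simp
    also have "\<dots> = expectation (\<lambda>\<omega>. c * h \<omega>)"
      using X(2) by (intro integral_cong_AE) auto
    finally show ?thesis by simp
  qed
  have Re: "expectation (\<lambda>\<omega>. Re (H \<omega>) * X \<omega>) = c * expectation (\<lambda>\<omega>. Re (H \<omega>))"
    using H by (intro real) (auto intro: order_trans[OF abs_Re_le_cmod])
  have Im: "expectation (\<lambda>\<omega>. Im (H \<omega>) * X \<omega>) = c * expectation (\<lambda>\<omega>. Im (H \<omega>))"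
    using H by (intro real) (auto intro: order_trans[OF abs_Im_le_cmod])
  show "expectation (\<lambda>\<omega>. H \<omega> * X \<omega>) = c * expectation H"
  proof (rule complex_eqI)
    show "Re (expectation (\<lambda>\<omega>. H \<omega> * X \<omega>)) = Re (c * expectation H)"
      using Re unfolding integral_Re[OF int, symmetric] integral_Re[OF intH] by simp
    show "Im (expectation (\<lambda>\<omega>. H \<omega> * X \<omega>)) = Im (c * expectation H)"
      using Im unfolding integral_Im[OF int, symmetric] integral_Im[OF intH] by simp
  qed
qed

text \<open>Times are shifted by one: \<open>\<epsilon> (Suc t)\<close> is the innovation following
  \<open>F t\<close>, so a predictable weight \<open>a t\<close> is \<open>F t\<close>-measurable
  and multiplies \<open>\<epsilon> (Suc t)\<close>. Sums then run over \<open>t < n\<close>.\<close>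

locale adaptive_noise = prob_space M for M :: "'a measure" +
  fixes F :: "nat \<Rightarrow> 'a measure" and \<epsilon> :: "nat \<Rightarrow> 'a \<Rightarrow> real" and \<sigma> \<delta> :: real
  assumes subalg: "\<And>t. subalgebra M (F t)"
    and F_mono: "\<And>s t. s \<le> t \<Longrightarrow> subalgebra (F t) (F s)"
    and adapted: "\<And>t. \<epsilon> (Suc t) \<in> borel_measurable (F (Suc t))"
    and \<sigma>: "\<sigma> > 0" and \<delta>: "\<delta> > 0"
    and mean: "\<And>t. AE \<omega> in M. real_cond_exp M (F t) (\<epsilon> (Suc t)) \<omega> = 0"
    and var: "\<And>t. AE \<omega> in M. nn_cond_exp M (F t) (\<lambda>\<omega>. ennreal ((\<epsilon> (Suc t) \<omega>)\<^sup>2)) \<omega> = ennreal (\<sigma>\<^sup>2)"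
    and cond_moment_bounded: "AE \<omega> in M. (SUP t. nn_cond_exp M (F t)
      (\<lambda>\<omega>. ennreal (\<bar>\<epsilon> (Suc t) \<omega> / \<sigma>\<bar> powr (2 + \<delta>))) \<omega>) < \<infinity>"
begin

definition moment :: "nat \<Rightarrow> 'a \<Rightarrow> ennreal" where
  "moment t = nn_cond_exp M (F t) (\<lambda>\<omega>. ennreal (\<bar>\<epsilon> (Suc t) \<omega> / \<sigma>\<bar> powr (2 + \<delta>)))"

lemma eps_measurable [measurable]: "\<epsilon> (Suc t) \<in> borel_measurable M"
  using measurable_from_subalg[OF subalg adapted] .

lemma measurable_F: "f \<in> borel_measurable (F t) \<Longrightarrow> f \<in> borel_measurable M"
  by (rule measurable_from_subalg[OF subalg])

lemma space_F: "space (F t) = space M"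
  using subalg by (simp add: subalgebra_def)

lemma sub_F: "finite_measure_subalgebra M (F t)"
  by unfold_locales (rule subalg)

lemma moment_measurable [measurable]: "moment t \<in> borel_measurable (F t)"
  unfolding moment_def by (rule borel_measurable_nn_cond_exp)

lemma nn_integral_mult_eps_sq:
  assumes "h \<in> borel_measurable (F t)"
  shows "(\<integral>\<^sup>+\<omega>. h \<omega> * ennreal ((\<epsilon> (Suc t) \<omega>)\<^sup>2) \<partial>M) = (\<integral>\<^sup>+\<omega>. h \<omega> * ennreal (\<sigma>\<^sup>2) \<partial>M)"
proof -
  interpret G: finite_measure_subalgebra M "F t" by (rule sub_F)
  have "(\<integral>\<^sup>+\<omega>. h \<omega> * ennreal ((\<epsilon> (Suc t) \<omega>)\<^sup>2) \<partial>M) =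
      (\<integral>\<^sup>+\<omega>. h \<omega> * nn_cond_exp M (F t) (\<lambda>\<omega>. ennreal ((\<epsilon> (Suc t) \<omega>)\<^sup>2)) \<omega> \<partial>M)"
    by (rule G.nn_cond_exp_intg[symmetric]) (use assms in auto)
  also have "\<dots> = (\<integral>\<^sup>+\<omega>. h \<omega> * ennreal (\<sigma>\<^sup>2) \<partial>M)"
    using var[of t] by (intro nn_integral_cong_AE) auto
  finally show ?thesis .
qed

text \<open>Square integrability is not assumed: testing the conditional variance against the weight
  1 shows that the second moment is \<open>\<sigma>^2\<close>.\<close>

lemma integrable_eps_sq: "integrable M (\<lambda>\<omega>. (\<epsilon> (Suc t) \<omega>)\<^sup>2)"
  using nn_integral_mult_eps_sq[of "\<lambda>_. 1" t]
  by (intro integrableI_bounded) (auto simp: emeasure_space_1)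

lemma integrable_eps: "integrable M (\<epsilon> (Suc t))"
  using integrable_eps_sq by (rule square_integrable_imp_integrable[rotated]) simp

lemma real_cond_exp_eps_sq: "AE \<omega> in M. real_cond_exp M (F t) (\<lambda>\<omega>. (\<epsilon> (Suc t) \<omega>)\<^sup>2) \<omega> = \<sigma>\<^sup>2"
proof -
  interpret G: finite_measure_subalgebra M "F t" by (rule sub_F)
  have "AE \<omega> in M. 0 = nn_cond_exp M (F t) (\<lambda>_. 0) \<omega>"
    by (rule G.nn_cond_exp_F_meas) simp
  then show ?thesis
    using var[of t] unfolding real_cond_exp_def by (auto simp: ennreal_neg)
qed

lemma nn_integral_mult_moment_le:
  assumes h: "h \<in> borel_measurable (F t)"
    and 0: "\<And>\<omega>. \<omega> \<in> space M \<Longrightarrow> moment t \<omega> > K \<Longrightarrow> h \<omega> = 0"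
  shows "(\<integral>\<^sup>+\<omega>. h \<omega> * ennreal (\<bar>\<epsilon> (Suc t) \<omega> / \<sigma>\<bar> powr (2 + \<delta>)) \<partial>M) \<le> (\<integral>\<^sup>+\<omega>. h \<omega> * K \<partial>M)"
proof -
  interpret G: finite_measure_subalgebra M "F t" by (rule sub_F)
  have "(\<integral>\<^sup>+\<omega>. h \<omega> * ennreal (\<bar>\<epsilon> (Suc t) \<omega> / \<sigma>\<bar> powr (2 + \<delta>)) \<partial>M) =
      (\<integral>\<^sup>+\<omega>. h \<omega> * moment t \<omega> \<partial>M)"
    unfolding moment_def by (rule G.nn_cond_exp_intg[symmetric]) (use h in auto)
  also have "\<dots> \<le> (\<integral>\<^sup>+\<omega>. h \<omega> * K \<partial>M)"
    using 0 by (intro nn_integral_mono) (metis mult_left_mono mult_zero_left not_less order_refl zero_le)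
  finally show ?thesis .
qed

text \<open>The Taylor remainder is controlled by powers between 2 and 3 only, so a moment of higher
  order is used at exponent at most 3.\<close>

definition "\<kappa> = min \<delta> 1"

lemma \<kappa>: "0 < \<kappa>" "\<kappa> \<le> 1" "\<kappa> \<le> \<delta>"
  using \<delta> by (auto simp: \<kappa>_def)

text \<open>Error per unit of squared weight when weights are at most \<open>r\<close>. The first
  term bounds the remainder of \<open>iexp\<close>, with
  \<open>1 + \<sigma> powr (2 + \<delta>) * K\<close> bounding the conditional moment of order
  \<open>2 + \<kappa>\<close>; the second is the remainder \<open>(\<sigma>^2 a^2 / 2)^2 / 2\<close>
  of the Gaussian factor, divided by \<open>a^2\<close>.\<close>

definition rate :: "real \<Rightarrow> real \<Rightarrow> real" where
  "rate K r = (1 + \<sigma> powr (2 + \<delta>) * K) * r powr \<kappa> + \<sigma> ^ 4 / 8 * r\<^sup>2"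

lemma rate_measurable [measurable]: "rate K \<in> borel_measurable borel"
  unfolding rate_def by measurable

lemma rate_nonneg: "0 \<le> K \<Longrightarrow> 0 \<le> rate K r"
  unfolding rate_def by (intro add_nonneg_nonneg mult_nonneg_nonneg) auto

lemma rate_mono:
  assumes "0 \<le> K" "0 \<le> r" "r \<le> s"
  shows "rate K r \<le> rate K s"
  unfolding rate_def using assms \<kappa>
  by (intro add_mono mult_left_mono powr_mono2 power_mono) auto

text \<open>Given \<open>F t\<close>, the second-order Taylor polynomials of both exponentials have
  the same expectation, by the conditional mean and variance, so only remainders survive. The factor
  \<open>(a \<omega>)\<^sup>2\<close> is kept in the bound so that the errors can be summed over
  time.\<close>

lemma cond_char_step:
  fixes H :: "'a \<Rightarrow> complex" and a r :: "'a \<Rightarrow> real"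
  assumes H: "H \<in> borel_measurable (F t)" "\<And>\<omega>. \<omega> \<in> space M \<Longrightarrow> cmod (H \<omega>) \<le> C"
    and a: "a \<in> borel_measurable (F t)" "\<And>\<omega>. \<omega> \<in> space M \<Longrightarrow> \<bar>a \<omega>\<bar> \<le> r \<omega>"
    and r: "r \<in> borel_measurable M" "\<And>\<omega>. \<omega> \<in> space M \<Longrightarrow> r \<omega> \<le> B"
    and K: "K \<ge> 0" "\<And>\<omega>. \<omega> \<in> space M \<Longrightarrow> moment t \<omega> > ennreal K \<Longrightarrow> a \<omega> = 0"
  shows "cmod (expectation (\<lambda>\<omega>. H \<omega> * (iexp (a \<omega> * \<epsilon> (Suc t) \<omega>) - exp (- (\<sigma>\<^sup>2 * (a \<omega>)\<^sup>2) / 2))))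
    \<le> C * expectation (\<lambda>\<omega>. (a \<omega>)\<^sup>2 * rate K (r \<omega>))"
proof -
  let ?e = "\<epsilon> (Suc t)"
  note [measurable] = measurable_F[OF H(1)] measurable_F[OF a(1)] r(1)
  have C: "0 \<le> C" using not_empty H(2) norm_ge_zero order_trans by blast
  have r0: "0 \<le> r \<omega>" if "\<omega> \<in> space M" for \<omega> using a(2)[OF that] by linarith
  have B: "0 \<le> B" using not_empty r0 r(2) order_trans by blast
  have aB: "\<bar>a \<omega>\<bar> \<le> B" if "\<omega> \<in> space M" for \<omega> using a(2)[OF that] r(2)[OF that] by linarith
  have aB2: "(a \<omega>)\<^sup>2 \<le> B\<^sup>2" if "\<omega> \<in> space M" for \<omega>
    using aB[OF that] by (metis abs_ge_zero power2_abs power_mono)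
  define Q where "Q z = iexp z - (1 + \<i> * z - z\<^sup>2 / 2)" for z :: real
  define R where "R y = exp (- y) - (1 - y)" for y :: real
  have [measurable]: "Q \<in> borel_measurable borel" "R \<in> borel_measurable borel"
    unfolding Q_def R_def by measurable
  define y where "y \<omega> = \<sigma>\<^sup>2 * (a \<omega>)\<^sup>2 / 2" for \<omega>
  have [measurable]: "y \<in> borel_measurable M" unfolding y_def by measurable
  define q where "q \<omega> = cmod (Q (a \<omega> * ?e \<omega>))" for \<omega>
  have [measurable]: "q \<in> borel_measurable M" unfolding q_def by measurable
  have split: "H \<omega> * (iexp (a \<omega> * ?e \<omega>) - exp (- (\<sigma>\<^sup>2 * (a \<omega>)\<^sup>2) / 2)) =
      (H \<omega> * \<i> * a \<omega>) * ?e \<omega> - (H \<omega> * (a \<omega>)\<^sup>2 / 2) * (?e \<omega>)\<^sup>2 + (H \<omega> * (a \<omega>)\<^sup>2 / 2) * \<sigma>\<^sup>2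
      + H \<omega> * (Q (a \<omega> * ?e \<omega>) - R (y \<omega>))" for \<omega>
    by (simp add: Q_def R_def y_def algebra_simps power_mult_distrib)
  have H1: "(\<lambda>\<omega>. H \<omega> * \<i> * a \<omega>) \<in> borel_measurable (F t)"
    and H2: "(\<lambda>\<omega>. H \<omega> * (a \<omega>)\<^sup>2 / 2) \<in> borel_measurable (F t)"
    using H(1) a(1) by measurable
  have H1b: "cmod (H \<omega> * \<i> * a \<omega>) \<le> C * B" if "\<omega> \<in> space M" for \<omega>
    using H(2)[OF that] aB[OF that] C B by (simp add: norm_mult mult_mono)
  have H2b: "cmod (H \<omega> * (a \<omega>)\<^sup>2 / 2) \<le> C * B\<^sup>2" if "\<omega> \<in> space M" for \<omega>
  proof -
    have "cmod (H \<omega> * (a \<omega>)\<^sup>2 / 2) \<le> cmod (H \<omega>) * (a \<omega>)\<^sup>2"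
      by (simp add: norm_mult norm_divide norm_power)
    also have "\<dots> \<le> C * B\<^sup>2" using H(2)[OF that] aB2[OF that] C by (intro mult_mono) auto
    finally show ?thesis .
  qed
  note E1 = expectation_mult_const_cond_exp[OF subalg integrable_eps mean H1 H1b]
  note E2 = expectation_mult_const_cond_exp[OF subalg integrable_eps_sq real_cond_exp_eps_sq H2 H2b]
  have E3: "integrable M (\<lambda>\<omega>. (H \<omega> * (a \<omega>)\<^sup>2 / 2) * \<sigma>\<^sup>2)"
    using measurable_F[OF H2] H2b by (intro integrable_mult_left integrable_const_bound[of _ "C * B\<^sup>2"]) auto
  have q_le: "q \<omega> \<le> B\<^sup>2 * (?e \<omega>)\<^sup>2" if "\<omega> \<in> space M" for \<omega>
  proof -
    have "q \<omega> \<le> (a \<omega> * ?e \<omega>)\<^sup>2" unfolding q_def Q_def by (rule iexp_second_order(2)[OF \<kappa>(1,2)])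
    also have "\<dots> \<le> B\<^sup>2 * (?e \<omega>)\<^sup>2"
      using aB2[OF that] by (simp add: power_mult_distrib mult_right_mono)
    finally show ?thesis .
  qed
  have intq: "integrable M q"
    by (rule Bochner_Integration.integrable_bound[OF integrable_mult_right[OF integrable_eps_sq[of t], of "B\<^sup>2"]])
      (use q_le in \<open>auto simp: q_def intro!: AE_I2\<close>)
  have R_le: "\<bar>R (y \<omega>)\<bar> \<le> (a \<omega>)\<^sup>2 * (\<sigma> ^ 4 / 8 * (r \<omega>)\<^sup>2)" if "\<omega> \<in> space M" for \<omega>
  proof -
    have "\<bar>R (y \<omega>)\<bar> \<le> (y \<omega>)\<^sup>2 / 2" unfolding R_def by (rule exp_minus_second_order) (simp add: y_def)
    also have "\<dots> = (a \<omega>)\<^sup>2 * (\<sigma> ^ 4 / 8 * (a \<omega>)\<^sup>2)" by (simp add: y_def power2_eq_square power4_eq_xxxx)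
    also have "\<dots> \<le> (a \<omega>)\<^sup>2 * (\<sigma> ^ 4 / 8 * (r \<omega>)\<^sup>2)"
      using power_mono[OF a(2)[OF that], of 2] by (intro mult_left_mono) auto
    finally show ?thesis .
  qed
  have r2: "(r \<omega>)\<^sup>2 \<le> B\<^sup>2" if "\<omega> \<in> space M" for \<omega> using r0[OF that] r(2)[OF that] by (intro power_mono)
  have int_ar: "integrable M (\<lambda>\<omega>. (a \<omega>)\<^sup>2 * (\<sigma> ^ 4 / 8 * (r \<omega>)\<^sup>2))"
    using aB2 r2 by (intro integrable_const_bound[of _ "B\<^sup>2 * (\<sigma> ^ 4 / 8 * B\<^sup>2)"] AE_I2)
      (auto simp: abs_mult intro!: mult_mono)
  have intR: "integrable M (\<lambda>\<omega>. \<bar>R (y \<omega>)\<bar>)"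
    using int_ar by (rule Bochner_Integration.integrable_bound) (use R_le in \<open>auto intro!: AE_I2 simp: abs_mult\<close>)
  have int_ark: "integrable M (\<lambda>\<omega>. (a \<omega>)\<^sup>2 * ((1 + \<sigma> powr (2 + \<delta>) * K) * r \<omega> powr \<kappa>))"
    using aB2 r(2) r0 K(1) \<kappa> by (intro integrable_const_bound[of _ "B\<^sup>2 * ((1 + \<sigma> powr (2 + \<delta>) * K) * B powr \<kappa>)"] AE_I2)
      (auto simp: abs_mult intro!: mult_mono powr_mono2)
  define h where "h \<omega> = \<bar>a \<omega>\<bar> powr (2 + \<kappa>)" for \<omega>
  have h_meas: "h \<in> borel_measurable (F t)" unfolding h_def using a(1) by measurable
  note [measurable] = measurable_F[OF h_meas]
  have h_le: "h \<omega> \<le> (a \<omega>)\<^sup>2 * r \<omega> powr \<kappa>" if "\<omega> \<in> space M" for \<omega>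
  proof -
    have "h \<omega> = (a \<omega>)\<^sup>2 * \<bar>a \<omega>\<bar> powr \<kappa>"
      by (cases "a \<omega> = 0") (simp_all add: h_def powr_add powr_numeral)
    also have "\<dots> \<le> (a \<omega>)\<^sup>2 * r \<omega> powr \<kappa>"
      using a(2)[OF that] \<kappa>(1) by (intro mult_left_mono powr_mono2) auto
    finally show ?thesis .
  qed
  \<comment> \<open>The added 1 covers small noise values, for which the lower power
    \<open>2 + \<kappa>\<close> may exceed the power \<open>2 + \<delta>\<close>.\<close>
  have pw: "\<bar>?e \<omega>\<bar> powr (2 + \<kappa>) \<le> 1 + \<sigma> powr (2 + \<delta>) * \<bar>?e \<omega> / \<sigma>\<bar> powr (2 + \<delta>)" for \<omega>
  proof -
    have "\<sigma> powr (2 + \<delta>) * \<bar>?e \<omega> / \<sigma>\<bar> powr (2 + \<delta>) = \<bar>?e \<omega>\<bar> powr (2 + \<delta>)"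
      using \<sigma> by (simp add: powr_mult[symmetric])
    moreover have "\<bar>?e \<omega>\<bar> powr (2 + \<kappa>) \<le> 1 + \<bar>?e \<omega>\<bar> powr (2 + \<delta>)"
    proof (cases "\<bar>?e \<omega>\<bar> \<le> 1")
      case True
      then have "\<bar>?e \<omega>\<bar> powr (2 + \<kappa>) \<le> 1 powr (2 + \<kappa>)" using \<kappa> by (intro powr_mono2) auto
      then show ?thesis by (simp add: add_increasing2)
    next
      case False
      then have "\<bar>?e \<omega>\<bar> powr (2 + \<kappa>) \<le> \<bar>?e \<omega>\<bar> powr (2 + \<delta>)" using \<kappa> by (intro powr_mono) auto
      then show ?thesis by simp
    qed
    ultimately show ?thesis by simp
  qed
  have Eq: "expectation q \<le> expectation (\<lambda>\<omega>. (a \<omega>)\<^sup>2 * ((1 + \<sigma> powr (2 + \<delta>) * K) * r \<omega> powr \<kappa>))"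
  proof -
    let ?s = "\<sigma> powr (2 + \<delta>)"
    \<comment> \<open>The estimate runs in nonnegative integrals, because the moment of order
      \<open>2 + \<delta>\<close> may be infinite; \<open>h\<close> vanishes where its conditional
      version exceeds \<open>K\<close>.\<close>
    have "ennreal (expectation q) = (\<integral>\<^sup>+\<omega>. ennreal (q \<omega>) \<partial>M)"
      using intq by (intro nn_integral_eq_integral[symmetric]) (auto simp: q_def)
    also have "\<dots> \<le> (\<integral>\<^sup>+\<omega>. ennreal (h \<omega>) + ennreal (h \<omega> * ?s) * ennreal (\<bar>?e \<omega> / \<sigma>\<bar> powr (2 + \<delta>)) \<partial>M)"
    proof (intro nn_integral_mono)
      fix \<omega>
      have "q \<omega> \<le> \<bar>a \<omega> * ?e \<omega>\<bar> powr (2 + \<kappa>)" unfolding q_def Q_def by (rule iexp_second_order(1)[OF \<kappa>(1,2)])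
      also have "\<dots> = h \<omega> * \<bar>?e \<omega>\<bar> powr (2 + \<kappa>)" by (simp add: h_def abs_mult powr_mult)
      also have "\<dots> \<le> h \<omega> * (1 + ?s * \<bar>?e \<omega> / \<sigma>\<bar> powr (2 + \<delta>))"
        using pw by (intro mult_left_mono) (auto simp: h_def)
      finally have "q \<omega> \<le> h \<omega> + h \<omega> * ?s * \<bar>?e \<omega> / \<sigma>\<bar> powr (2 + \<delta>)" by (simp add: algebra_simps)
      then have "ennreal (q \<omega>) \<le> ennreal (h \<omega> + h \<omega> * ?s * \<bar>?e \<omega> / \<sigma>\<bar> powr (2 + \<delta>))"
        by (rule ennreal_leI)
      also have "\<dots> = ennreal (h \<omega>) + ennreal (h \<omega> * ?s) * ennreal (\<bar>?e \<omega> / \<sigma>\<bar> powr (2 + \<delta>))"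
        by (subst ennreal_plus) (auto simp: h_def ennreal_mult)
      finally show "ennreal (q \<omega>) \<le> ennreal (h \<omega>) + ennreal (h \<omega> * ?s) * ennreal (\<bar>?e \<omega> / \<sigma>\<bar> powr (2 + \<delta>))" .
    qed
    also have "\<dots> = (\<integral>\<^sup>+\<omega>. ennreal (h \<omega>) \<partial>M) +
        (\<integral>\<^sup>+\<omega>. ennreal (h \<omega> * ?s) * ennreal (\<bar>?e \<omega> / \<sigma>\<bar> powr (2 + \<delta>)) \<partial>M)"
      by (rule nn_integral_add) auto
    also have "\<dots> \<le> (\<integral>\<^sup>+\<omega>. ennreal (h \<omega>) \<partial>M) + (\<integral>\<^sup>+\<omega>. ennreal (h \<omega> * ?s) * ennreal K \<partial>M)"
    proof (intro add_left_mono nn_integral_mult_moment_le)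
      show "(\<lambda>\<omega>. ennreal (h \<omega> * ?s)) \<in> borel_measurable (F t)" using h_meas by measurable
    qed (use K(2) in \<open>auto simp: h_def\<close>)
    also have "\<dots> = (\<integral>\<^sup>+\<omega>. ennreal (h \<omega>) + ennreal (h \<omega> * ?s) * ennreal K \<partial>M)"
      by (rule nn_integral_add[symmetric]) auto
    also have "\<dots> \<le> (\<integral>\<^sup>+\<omega>. ennreal ((a \<omega>)\<^sup>2 * ((1 + ?s * K) * r \<omega> powr \<kappa>)) \<partial>M)"
    proof (intro nn_integral_mono)
      fix \<omega> assume \<omega>: "\<omega> \<in> space M"
      have "ennreal (h \<omega>) + ennreal (h \<omega> * ?s) * ennreal K = ennreal (h \<omega> + h \<omega> * ?s * K)"
        using K(1) by (subst ennreal_plus) (auto simp: h_def ennreal_mult)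
      also have "h \<omega> + h \<omega> * ?s * K = h \<omega> * (1 + ?s * K)" by (simp add: algebra_simps)
      also have "ennreal \<dots> \<le> ennreal ((a \<omega>)\<^sup>2 * r \<omega> powr \<kappa> * (1 + ?s * K))"
        using h_le[OF \<omega>] K(1) by (intro ennreal_leI mult_right_mono) auto
      finally show "ennreal (h \<omega>) + ennreal (h \<omega> * ?s) * ennreal K \<le> ennreal ((a \<omega>)\<^sup>2 * ((1 + ?s * K) * r \<omega> powr \<kappa>))"
        by (simp add: ac_simps)
    qed
    also have "\<dots> = ennreal (expectation (\<lambda>\<omega>. (a \<omega>)\<^sup>2 * ((1 + ?s * K) * r \<omega> powr \<kappa>)))"
      using K(1) by (intro nn_integral_eq_integral int_ark) auto
    finally show ?thesis
      using K(1) by (subst (asm) ennreal_le_iff) (auto intro!: integral_nonneg_AE)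
  qed
  have intQR: "integrable M (\<lambda>\<omega>. H \<omega> * (Q (a \<omega> * ?e \<omega>) - R (y \<omega>)))"
  proof (rule Bochner_Integration.integrable_bound)
    show "integrable M (\<lambda>\<omega>. C * (q \<omega> + \<bar>R (y \<omega>)\<bar>))" using intq intR by simp
    show "AE \<omega> in M. cmod (H \<omega> * (Q (a \<omega> * ?e \<omega>) - R (y \<omega>))) \<le> norm (C * (q \<omega> + \<bar>R (y \<omega>)\<bar>))"
    proof (intro AE_I2)
      fix \<omega> assume "\<omega> \<in> space M"
      have "cmod (Q (a \<omega> * ?e \<omega>) - R (y \<omega>)) \<le> q \<omega> + \<bar>R (y \<omega>)\<bar>"
        unfolding q_def by (metis norm_of_real norm_triangle_ineq4)
      then show "cmod (H \<omega> * (Q (a \<omega> * ?e \<omega>) - R (y \<omega>))) \<le> norm (C * (q \<omega> + \<bar>R (y \<omega>)\<bar>))"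
        using H(2)[OF \<open>\<omega> \<in> space M\<close>] C by (auto simp: norm_mult q_def abs_mult intro!: mult_mono)
    qed
  qed measurable
  have "expectation (\<lambda>\<omega>. H \<omega> * (iexp (a \<omega> * ?e \<omega>) - exp (- (\<sigma>\<^sup>2 * (a \<omega>)\<^sup>2) / 2))) =
      expectation (\<lambda>\<omega>. H \<omega> * (Q (a \<omega> * ?e \<omega>) - R (y \<omega>)))"
    unfolding split using E1 E2 E3 intQR
    by (simp add: Bochner_Integration.integral_add Bochner_Integration.integral_diff mult.commute)
  also have "cmod \<dots> \<le> expectation (\<lambda>\<omega>. cmod (H \<omega> * (Q (a \<omega> * ?e \<omega>) - R (y \<omega>))))"
    by (rule integral_norm_bound)
  also have "\<dots> \<le> expectation (\<lambda>\<omega>. C * (q \<omega> + \<bar>R (y \<omega>)\<bar>))"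
  proof (rule integral_mono)
    fix \<omega> assume "\<omega> \<in> space M"
    have "cmod (Q (a \<omega> * ?e \<omega>) - R (y \<omega>)) \<le> q \<omega> + \<bar>R (y \<omega>)\<bar>"
      unfolding q_def by (metis norm_of_real norm_triangle_ineq4)
    then show "cmod (H \<omega> * (Q (a \<omega> * ?e \<omega>) - R (y \<omega>))) \<le> C * (q \<omega> + \<bar>R (y \<omega>)\<bar>)"
      using H(2)[OF \<open>\<omega> \<in> space M\<close>] C by (auto simp: norm_mult intro!: mult_mono)
  qed (use intQR intq intR in auto)
  also have "\<dots> = C * (expectation q + expectation (\<lambda>\<omega>. \<bar>R (y \<omega>)\<bar>))"
    using intq intR by simp
  also have "\<dots> \<le> C * (expectation (\<lambda>\<omega>. (a \<omega>)\<^sup>2 * ((1 + \<sigma> powr (2 + \<delta>) * K) * r \<omega> powr \<kappa>)) +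
      expectation (\<lambda>\<omega>. (a \<omega>)\<^sup>2 * (\<sigma> ^ 4 / 8 * (r \<omega>)\<^sup>2)))"
    by (intro mult_left_mono add_mono Eq C integral_mono[OF intR int_ar R_le])
  also have "\<dots> = C * expectation (\<lambda>\<omega>. (a \<omega>)\<^sup>2 * rate K (r \<omega>))"
    using int_ark int_ar by (subst Bochner_Integration.integral_add[symmetric]) (auto simp: rate_def distrib_left)
  finally show ?thesis .
qed

section \<open>Predictably weighted sums of the noise\<close>

lemma weighted_sum_measurable:
  assumes "\<And>t. t < n \<Longrightarrow> a t \<in> borel_measurable (F t)"
  shows "(\<lambda>\<omega>. \<Sum>t<n. a t \<omega> * \<epsilon> (Suc t) \<omega>) \<in> borel_measurable (F n)"
proof (intro borel_measurable_sum borel_measurable_times)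
  fix t assume "t \<in> {..<n}"
  then show "a t \<in> borel_measurable (F n)" "\<epsilon> (Suc t) \<in> borel_measurable (F n)"
    using measurable_from_subalg[OF F_mono assms] measurable_from_subalg[OF F_mono adapted] by auto
qed

lemma weighted_sum_char_bound:
  fixes a :: "nat \<Rightarrow> 'a \<Rightarrow> real"
  assumes a: "\<And>t. t < n \<Longrightarrow> a t \<in> borel_measurable (F t)"
      "\<And>t \<omega>. t < n \<Longrightarrow> \<omega> \<in> space M \<Longrightarrow> \<bar>a t \<omega>\<bar> \<le> r \<omega>"
      "\<And>\<omega>. \<omega> \<in> space M \<Longrightarrow> (\<Sum>t<n. (a t \<omega>)\<^sup>2) \<le> L"
    and r: "r \<in> borel_measurable M" "\<And>\<omega>. \<omega> \<in> space M \<Longrightarrow> 0 \<le> r \<omega>" "\<And>\<omega>. \<omega> \<in> space M \<Longrightarrow> r \<omega> \<le> B"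
    and K: "K \<ge> 0" "\<And>t \<omega>. t < n \<Longrightarrow> \<omega> \<in> space M \<Longrightarrow> moment t \<omega> > ennreal K \<Longrightarrow> a t \<omega> = 0"
  shows "cmod (expectation (\<lambda>\<omega>. iexp (\<Sum>t<n. a t \<omega> * \<epsilon> (Suc t) \<omega>) * exp (\<sigma>\<^sup>2 * (\<Sum>t<n. (a t \<omega>)\<^sup>2) / 2)) - 1)
    \<le> exp (\<sigma>\<^sup>2 * L / 2) * L * expectation (\<lambda>\<omega>. rate K (r \<omega>))"
proof -
  define S where "S m \<omega> = (\<Sum>t<m. a t \<omega> * \<epsilon> (Suc t) \<omega>)" for m \<omega>
  define T where "T m \<omega> = (\<Sum>t<m. (a t \<omega>)\<^sup>2)" for m \<omega>
  define Z where "Z m \<omega> = iexp (S m \<omega>) * exp (\<sigma>\<^sup>2 * T m \<omega> / 2)" for m \<omega>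
  define C where "C = exp (\<sigma>\<^sup>2 * L / 2)"
  note [measurable] = r(1)
  have S_meas: "S m \<in> borel_measurable (F m)" if "m \<le> n" for m
    unfolding S_def using that a(1) by (intro weighted_sum_measurable) auto
  have T_meas: "T (Suc m) \<in> borel_measurable (F m)" if "m < n" for m
    unfolding T_def
  proof (intro borel_measurable_sum borel_measurable_power)
    fix t assume "t \<in> {..<Suc m}"
    then show "a t \<in> borel_measurable (F m)"
      using that by (intro measurable_from_subalg[OF F_mono a(1)]) auto
  qed
  have T_meas': "T m \<in> borel_measurable M" if "m \<le> n" for m
  proof (cases m)
    case 0
    have "T 0 = (\<lambda>_. 0)" by (simp add: T_def fun_eq_iff)
    with 0 show ?thesis by simp
  next
    case (Suc k) then show ?thesis using measurable_F[OF T_meas[of k]] that by simp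
  qed
  have T_le: "T m \<omega> \<le> L" if "m \<le> n" "\<omega> \<in> space M" for m \<omega>
    using sum_mono2[of "{..<n}" "{..<m}" "\<lambda>t. (a t \<omega>)\<^sup>2"] a(3)[OF that(2)] that(1) by (auto simp: T_def)
  have T0: "0 \<le> T m \<omega>" for m \<omega> by (simp add: T_def sum_nonneg)
  have exp_le: "exp (\<sigma>\<^sup>2 * T m \<omega> / 2) \<le> C" if "m \<le> n" "\<omega> \<in> space M" for m \<omega>
    using T_le[OF that] by (simp add: C_def mult_left_mono)
  have Z_int: "integrable M (Z m)" if "m \<le> n" for m
  proof -
    note [measurable] = measurable_F[OF S_meas[OF that]] T_meas'[OF that]
    have "Z m \<in> borel_measurable M" unfolding Z_def by measurable
    then show ?thesis
      using exp_le[OF that] by (intro integrable_const_bound[of _ C]) (auto simp: Z_def norm_mult)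
  qed
  have TR_int: "integrable M (\<lambda>\<omega>. f \<omega> * rate K (r \<omega>))"
    if "f \<in> borel_measurable M" "\<And>\<omega>. \<omega> \<in> space M \<Longrightarrow> 0 \<le> f \<omega>" "\<And>\<omega>. \<omega> \<in> space M \<Longrightarrow> f \<omega> \<le> L'" for f L'
    using that r(2,3) rate_nonneg[OF K(1)] rate_mono[OF K(1)]
    by (intro integrable_const_bound[of _ "L' * rate K B"] AE_I2)
      (auto simp: abs_mult intro!: mult_mono intro: order_trans)
  \<comment> \<open>The induction carries \<open>T m\<close> and not its bound \<open>L\<close>, so
    that each step adds exactly its own squared weight.\<close>
  have bound: "cmod (expectation (Z m) - 1) \<le> C * expectation (\<lambda>\<omega>. T m \<omega> * rate K (r \<omega>))" if "m \<le> n" for m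
    using that
  proof (induct m)
    case 0
    show ?case by (simp add: Z_def S_def T_def prob_space)
  next
    case (Suc m)
    \<comment> \<open>The compensator is taken one step ahead: \<open>T (Suc m)\<close> involves
      weights up to \<open>a m\<close> only and is \<open>F m\<close>-measurable, so
      \<open>H\<close> is an admissible multiplier for the step from \<open>m\<close>.\<close>
    define H where "H \<omega> = iexp (S m \<omega>) * exp (\<sigma>\<^sup>2 * T (Suc m) \<omega> / 2)" for \<omega>
    have m: "m < n" "m \<le> n" using Suc by auto
    note [measurable] = S_meas[OF m(2)] T_meas[OF m(1)]
    have H: "H \<in> borel_measurable (F m)" unfolding H_def by measurable
    have Hb: "cmod (H \<omega>) \<le> C" if "\<omega> \<in> space M" for \<omega>
      using exp_le[OF Suc.prems that] by (simp add: H_def norm_mult)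
    have eq: "Z (Suc m) \<omega> - Z m \<omega> = H \<omega> * (iexp (a m \<omega> * \<epsilon> (Suc m) \<omega>) - exp (- (\<sigma>\<^sup>2 * (a m \<omega>)\<^sup>2) / 2))" for \<omega>
    proof -
      have 1: "iexp (S (Suc m) \<omega>) = iexp (S m \<omega>) * iexp (a m \<omega> * \<epsilon> (Suc m) \<omega>)"
        by (simp add: S_def exp_add[symmetric] distrib_left)
      have 2: "exp (\<sigma>\<^sup>2 * T m \<omega> / 2) = exp (\<sigma>\<^sup>2 * T (Suc m) \<omega> / 2) * exp (- (\<sigma>\<^sup>2 * (a m \<omega>)\<^sup>2) / 2)"
        by (simp add: T_def exp_add[symmetric] algebra_simps add_divide_distrib[symmetric])
      show ?thesis unfolding Z_def H_def 1 2 by (simp add: algebra_simps)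
    qed
    have "expectation (Z (Suc m)) - 1 = (expectation (Z m) - 1) + expectation (\<lambda>\<omega>. Z (Suc m) \<omega> - Z m \<omega>)"
      using Z_int[OF Suc.prems] Z_int[OF m(2)] by simp
    also have "cmod \<dots> \<le> cmod (expectation (Z m) - 1) + cmod (expectation (\<lambda>\<omega>. Z (Suc m) \<omega> - Z m \<omega>))"
      by (rule norm_triangle_ineq)
    also have "\<dots> \<le> C * expectation (\<lambda>\<omega>. T m \<omega> * rate K (r \<omega>)) + C * expectation (\<lambda>\<omega>. (a m \<omega>)\<^sup>2 * rate K (r \<omega>))"
      unfolding eq
      by (intro add_mono Suc.hyps m(2) cond_char_step[OF H Hb a(1)[OF m(1)] a(2)[OF m(1)] r(1,3) K(1) K(2)[OF m(1)]])
    also have "\<dots> = C * expectation (\<lambda>\<omega>. T (Suc m) \<omega> * rate K (r \<omega>))"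
    proof -
      have "integrable M (\<lambda>\<omega>. T m \<omega> * rate K (r \<omega>))"
        by (rule TR_int[of _ L]) (use T_meas' T_le T0 m in auto)
      moreover have "integrable M (\<lambda>\<omega>. (a m \<omega>)\<^sup>2 * rate K (r \<omega>))"
      proof (rule TR_int[of _ L])
        show "(\<lambda>\<omega>. (a m \<omega>)\<^sup>2) \<in> borel_measurable M" using measurable_F[OF a(1)[OF m(1)]] by measurable
        show "(a m \<omega>)\<^sup>2 \<le> L" if "\<omega> \<in> space M" for \<omega>
          using T_le[OF Suc.prems that] T0[of m \<omega>] by (simp add: T_def)
      qed auto
      ultimately show ?thesis by (simp add: T_def distrib_right distrib_left)
    qed
    finally show ?case .
  qed
  have "cmod (expectation (Z n) - 1) \<le> C * expectation (\<lambda>\<omega>. T n \<omega> * rate K (r \<omega>))"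
    by (rule bound) simp
  also have "\<dots> \<le> C * expectation (\<lambda>\<omega>. L * rate K (r \<omega>))"
  proof (intro mult_left_mono integral_mono TR_int)
    have "0 \<le> L" using not_empty T_le[of n] T0[of n] order_trans by blast
    then show "\<And>\<omega>. 0 \<le> L" .
  qed (use T_meas' T_le T0 rate_nonneg[OF K(1)] in \<open>auto simp: C_def intro!: mult_right_mono\<close>)
  finally show ?thesis
    unfolding Z_def S_def T_def C_def by (simp add: mult.assoc)
qed

text \<open>Orthogonality of martingale increments; this supplies the bounded second moments behind
  tightness.\<close>

lemma weighted_sum_second_moment:
  fixes a :: "nat \<Rightarrow> 'a \<Rightarrow> real"
  assumes a: "\<And>t. t < n \<Longrightarrow> a t \<in> borel_measurable (F t)"
      "\<And>t \<omega>. t < n \<Longrightarrow> \<omega> \<in> space M \<Longrightarrow> \<bar>a t \<omega>\<bar> \<le> B"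
  shows "integrable M (\<lambda>\<omega>. (\<Sum>t<n. a t \<omega> * \<epsilon> (Suc t) \<omega>)\<^sup>2)"
    and "expectation (\<lambda>\<omega>. (\<Sum>t<n. a t \<omega> * \<epsilon> (Suc t) \<omega>)\<^sup>2) = \<sigma>\<^sup>2 * expectation (\<lambda>\<omega>. \<Sum>t<n. (a t \<omega>)\<^sup>2)"
proof -
  define S where "S m \<omega> = (\<Sum>t<m. a t \<omega> * \<epsilon> (Suc t) \<omega>)" for m \<omega>
  have "integrable M (\<lambda>\<omega>. (S m \<omega>)\<^sup>2) \<and> integrable M (\<lambda>\<omega>. \<Sum>t<m. (a t \<omega>)\<^sup>2) \<and>
      expectation (\<lambda>\<omega>. (S m \<omega>)\<^sup>2) = \<sigma>\<^sup>2 * expectation (\<lambda>\<omega>. \<Sum>t<m. (a t \<omega>)\<^sup>2)" if "m \<le> n" for m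
    using that
  proof (induct m)
    case 0
    show ?case by (simp add: S_def)
  next
    case (Suc m)
    interpret G: finite_measure_subalgebra M "F m" by (rule sub_F)
    have m: "m < n" using Suc by simp
    have Sm: "S m \<in> borel_measurable (F m)"
      unfolding S_def using m a(1) by (intro weighted_sum_measurable) auto
    note am = a(1)[OF m]
    note [measurable] = measurable_F[OF Sm] measurable_F[OF am]
    have IH: "integrable M (\<lambda>\<omega>. (S m \<omega>)\<^sup>2)" "integrable M (\<lambda>\<omega>. \<Sum>t<m. (a t \<omega>)\<^sup>2)"
      "expectation (\<lambda>\<omega>. (S m \<omega>)\<^sup>2) = \<sigma>\<^sup>2 * expectation (\<lambda>\<omega>. \<Sum>t<m. (a t \<omega>)\<^sup>2)" using Suc by auto
    have aB2: "(a m \<omega>)\<^sup>2 \<le> B\<^sup>2" if "\<omega> \<in> space M" for \<omega>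
      using a(2)[OF m that] by (metis abs_ge_zero power2_abs power_mono)
    have int2: "integrable M (\<lambda>\<omega>. (a m \<omega>)\<^sup>2 * (\<epsilon> (Suc m) \<omega>)\<^sup>2)"
      by (rule Bochner_Integration.integrable_bound[OF integrable_mult_right[OF integrable_eps_sq[of m], of "B\<^sup>2"]])
        (use aB2 in \<open>auto simp: abs_mult intro!: AE_I2 mult_right_mono\<close>)
    have inta: "integrable M (\<lambda>\<omega>. (a m \<omega>)\<^sup>2)"
      using aB2 by (intro integrable_const_bound[of _ "B\<^sup>2"]) auto
    have int1: "integrable M (\<lambda>\<omega>. (S m \<omega> * a m \<omega>) * \<epsilon> (Suc m) \<omega>)"
    proof (rule Bochner_Integration.integrable_bound[OF Bochner_Integration.integrable_add[OF IH(1) int2]])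
      \<comment> \<open>The inequality of arithmetic and geometric means makes the cross term
        integrable from the two squares.\<close>
      have "\<bar>x * y * z\<bar> \<le> x\<^sup>2 + y\<^sup>2 * z\<^sup>2" for x y z :: real
      proof -
        have "2 * \<bar>x * (y * z)\<bar> \<le> x\<^sup>2 + (y * z)\<^sup>2"
          using sum_squares_bound[of "\<bar>x\<bar>" "\<bar>y * z\<bar>"] by (simp only: abs_mult[of x "y * z"] power2_abs mult.assoc)
        moreover have "0 \<le> \<bar>x * (y * z)\<bar>" by simp
        ultimately show ?thesis unfolding power_mult_distrib mult.assoc by linarith
      qed
      then show "AE \<omega> in M. norm (S m \<omega> * a m \<omega> * \<epsilon> (Suc m) \<omega>) \<le> norm ((S m \<omega>)\<^sup>2 + (a m \<omega>)\<^sup>2 * (\<epsilon> (Suc m) \<omega>)\<^sup>2)"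
        by (intro AE_I2) simp
    qed measurable
    have Sa: "(\<lambda>\<omega>. S m \<omega> * a m \<omega>) \<in> borel_measurable (F m)" and a2: "(\<lambda>\<omega>. (a m \<omega>)\<^sup>2) \<in> borel_measurable (F m)"
      using Sm am by measurable
    have "expectation (\<lambda>\<omega>. (S m \<omega> * a m \<omega>) * \<epsilon> (Suc m) \<omega>) =
        expectation (\<lambda>\<omega>. (S m \<omega> * a m \<omega>) * real_cond_exp M (F m) (\<epsilon> (Suc m)) \<omega>)"
      by (rule G.real_cond_exp_intg(2)[OF int1 Sa eps_measurable, symmetric])
    also have "\<dots> = expectation (\<lambda>\<omega>. 0)"
      using mean[of m] by (intro integral_cong_AE) auto
    finally have E1: "expectation (\<lambda>\<omega>. (S m \<omega> * a m \<omega>) * \<epsilon> (Suc m) \<omega>) = 0" by simp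
    have "expectation (\<lambda>\<omega>. (a m \<omega>)\<^sup>2 * (\<epsilon> (Suc m) \<omega>)\<^sup>2) =
        expectation (\<lambda>\<omega>. (a m \<omega>)\<^sup>2 * real_cond_exp M (F m) (\<lambda>\<omega>. (\<epsilon> (Suc m) \<omega>)\<^sup>2) \<omega>)"
      by (rule G.real_cond_exp_intg(2)[OF int2 a2, symmetric]) measurable
    also have "\<dots> = expectation (\<lambda>\<omega>. \<sigma>\<^sup>2 * (a m \<omega>)\<^sup>2)"
      using real_cond_exp_eps_sq[of m] by (intro integral_cong_AE) auto
    finally have E2: "expectation (\<lambda>\<omega>. (a m \<omega>)\<^sup>2 * (\<epsilon> (Suc m) \<omega>)\<^sup>2) = \<sigma>\<^sup>2 * expectation (\<lambda>\<omega>. (a m \<omega>)\<^sup>2)"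
      by simp
    have eq: "(\<lambda>\<omega>. (S (Suc m) \<omega>)\<^sup>2) =
        (\<lambda>\<omega>. (S m \<omega>)\<^sup>2 + 2 * ((S m \<omega> * a m \<omega>) * \<epsilon> (Suc m) \<omega>) + (a m \<omega>)\<^sup>2 * (\<epsilon> (Suc m) \<omega>)\<^sup>2)"
      by (simp add: S_def power2_sum power_mult_distrib algebra_simps)
    show ?case
      unfolding eq using IH int1 int2 inta E1 E2 by (simp add: distrib_left)
  qed
  from this[of n] show "integrable M (\<lambda>\<omega>. (\<Sum>t<n. a t \<omega> * \<epsilon> (Suc t) \<omega>)\<^sup>2)"
    and "expectation (\<lambda>\<omega>. (\<Sum>t<n. a t \<omega> * \<epsilon> (Suc t) \<omega>)\<^sup>2) = \<sigma>\<^sup>2 * expectation (\<lambda>\<omega>. \<Sum>t<n. (a t \<omega>)\<^sup>2)"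
    by (simp_all add: S_def)
qed

text \<open>The supremum over all times is almost surely finite, so it exceeds a large level with
  small probability. A single event serves every time, and off it the truncation at \<open>K\<close>
  changes no weight.\<close>

lemma moment_tail:
  assumes "e > 0"
  obtains K A where "K \<ge> 0" "A \<in> events" "prob A < e"
    "\<And>t \<omega>. \<omega> \<in> space M \<Longrightarrow> moment t \<omega> > ennreal K \<Longrightarrow> \<omega> \<in> A"
proof -
  define A where "A k = {\<omega> \<in> space M. (SUP t. moment t \<omega>) > ennreal (real k)}" for k
  have [measurable]: "moment t \<in> borel_measurable M" for t
    by (rule measurable_from_subalg[OF subalg moment_measurable])
  have A: "A k \<in> events" for k unfolding A_def by measurable
  have "decseq A"
    unfolding A_def decseq_def by (auto elim!: order_le_less_trans[rotated] intro!: ennreal_leI)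
  then have "(\<lambda>k. prob (A k)) \<longlonglongrightarrow> prob (\<Inter>k. A k)"
    using A by (intro finite_Lim_measure_decseq) auto
  moreover have "prob (\<Inter>k. A k) = 0"
  proof (subst prob_eq_0)
    show "(\<Inter>k. A k) \<in> events" using A by auto
    show "AE \<omega> in M. \<omega> \<notin> (\<Inter>k. A k)"
      using cond_moment_bounded[folded moment_def]
    proof eventually_elim
      case (elim \<omega>)
      then obtain k where "(SUP t. moment t \<omega>) < of_nat k"
        using ennreal_Ex_less_of_nat by (auto simp: less_top)
      then have "\<omega> \<notin> A k" by (auto simp: A_def ennreal_of_nat_eq_real_of_nat)
      then show ?case by blast
    qed
  qed
  ultimately have "(\<lambda>k. prob (A k)) \<longlonglongrightarrow> 0" by simp
  then have "\<forall>\<^sub>F k in sequentially. prob (A k) < e"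
    using assms by (rule order_tendstoD(2))
  then obtain k where "prob (A k) < e" by (auto simp: eventually_sequentially)
  moreover have "\<omega> \<in> A k" if "\<omega> \<in> space M" "moment t \<omega> > ennreal (real k)" for t \<omega>
    using less_le_trans[OF that(2) SUP_upper[of t UNIV "\<lambda>t. moment t \<omega>"]] that(1) by (simp add: A_def)
  ultimately show ?thesis using that[of "real k" "A k"] A by auto
qed

lemma rate_small:
  assumes "K \<ge> 0" "e > 0"
  shows "\<exists>d>0. \<forall>x. \<bar>x\<bar> \<le> d \<longrightarrow> \<bar>rate K \<bar>x\<bar>\<bar> \<le> e"
proof -
  have "((\<lambda>x. rate K \<bar>x\<bar>) \<longlongrightarrow> rate K \<bar>0\<bar>) (at 0)"
    unfolding rate_def by (intro tendsto_intros tendsto_powr') (use \<kappa>(1) in auto)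
  then have "((\<lambda>x. rate K \<bar>x\<bar>) \<longlongrightarrow> 0) (at 0)" by (simp add: rate_def)
  from tendstoD[OF this assms(2)] obtain d where d: "d > 0" "\<And>x. x \<noteq> 0 \<Longrightarrow> \<bar>x\<bar> < d \<Longrightarrow> \<bar>rate K \<bar>x\<bar>\<bar> < e"
    unfolding eventually_at by (auto simp: dist_real_def)
  have "\<bar>rate K \<bar>x\<bar>\<bar> \<le> e" if "\<bar>x\<bar> \<le> d / 2" for x
    using d(2)[of x] that d(1) assms(2) by (cases "x = 0") (auto simp: rate_def intro: less_imp_le)
  then show ?thesis using d(1) by (intro exI[of _ "d / 2"]) auto
qed

text \<open>Multiplied by \<open>C\<close>, the limit of the compensator, the characteristic
  function is compared with the mean of the truncated process \<open>Z n\<close>. Three errors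
  arise: the compensator against \<open>C\<close>, the truncation event \<open>A\<close>, and the
  distance of the mean of \<open>Z n\<close> from 1.\<close>

theorem weighted_sum_char_tendsto:
  fixes a :: "nat \<Rightarrow> nat \<Rightarrow> 'a \<Rightarrow> real"
  assumes a: "\<And>n t. t < n \<Longrightarrow> a n t \<in> borel_measurable (F t)"
      "\<And>n t \<omega>. t < n \<Longrightarrow> \<omega> \<in> space M \<Longrightarrow> \<bar>a n t \<omega>\<bar> \<le> r n \<omega>"
      "\<And>n \<omega>. \<omega> \<in> space M \<Longrightarrow> (\<Sum>t<n. (a n t \<omega>)\<^sup>2) \<le> L"
    and r: "\<And>n. r n \<in> borel_measurable M" "\<And>n \<omega>. \<omega> \<in> space M \<Longrightarrow> 0 \<le> r n \<omega>"
      "\<And>n \<omega>. \<omega> \<in> space M \<Longrightarrow> r n \<omega> \<le> B"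
    and r_lim: "tendsto_zero_in_prob M r"
    and var_lim: "tendsto_zero_in_prob M (\<lambda>n \<omega>. (\<Sum>t<n. (a n t \<omega>)\<^sup>2) - L)"
  shows "(\<lambda>n. expectation (\<lambda>\<omega>. iexp (\<Sum>t<n. a n t \<omega> * \<epsilon> (Suc t) \<omega>))) \<longlonglongrightarrow> exp (- (\<sigma>\<^sup>2 * L) / 2)"
proof -
  define S where "S n \<omega> = (\<Sum>t<n. a n t \<omega> * \<epsilon> (Suc t) \<omega>)" for n \<omega>
  define T where "T n \<omega> = (\<Sum>t<n. (a n t \<omega>)\<^sup>2)" for n \<omega>
  define C where "C = exp (\<sigma>\<^sup>2 * L / 2)"
  \<comment> \<open>Along the process \<open>T n - L\<close> is nonpositive; the \<open>min\<close>
    keeps \<open>g\<close> bounded on the whole line without changing it there.\<close>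
  define g where "g x = exp (\<sigma>\<^sup>2 * (min x 0 + L) / 2) - C" for x
  note [measurable] = r(1)
  have am [measurable]: "a n t \<in> borel_measurable M" if "t < n" for n t using measurable_F[OF a(1)[OF that]] .
  have [measurable]: "S n \<in> borel_measurable M" for n
    unfolding S_def using a(1) by (intro measurable_F[OF weighted_sum_measurable])
  have [measurable]: "T n \<in> borel_measurable M" for n
    unfolding T_def using am by (intro borel_measurable_sum borel_measurable_power) auto
  have [measurable]: "g \<in> borel_measurable borel" unfolding g_def by measurable
  have g_eq: "exp (\<sigma>\<^sup>2 * T n \<omega> / 2) - C = g (T n \<omega> - L)" if "\<omega> \<in> space M" for n \<omega>
    using a(3)[OF that, of n] by (simp add: g_def T_def min_def)
  have C0: "C > 0" by (simp add: C_def)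
  have g_le: "\<bar>g x\<bar> \<le> C" for x
  proof -
    have "exp (\<sigma>\<^sup>2 * (min x 0 + L) / 2) \<le> C"
      unfolding C_def by (simp add: mult_left_mono)
    then show ?thesis unfolding g_def using exp_gt_zero[of "\<sigma>\<^sup>2 * (min x 0 + L) / 2"] by linarith
  qed
  have g_lim: "(\<lambda>n. expectation (\<lambda>\<omega>. \<bar>g (T n \<omega> - L)\<bar>)) \<longlonglongrightarrow> 0"
  proof (rule expectation_tendsto_zero_in_prob[where g = g and X = "\<lambda>n \<omega>. T n \<omega> - L" and B = C])
    show "tendsto_zero_in_prob M (\<lambda>n \<omega>. T n \<omega> - L)" using var_lim by (simp add: T_def)
    fix e :: real assume "e > 0"
    have "isCont g 0" unfolding g_def by (intro continuous_intros) simp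
    moreover have "g 0 = 0" by (simp add: g_def C_def)
    ultimately obtain d where d: "d > 0" "\<And>x. \<bar>x\<bar> < d \<Longrightarrow> \<bar>g x\<bar> < e"
      using \<open>e > 0\<close> unfolding continuous_at_eps_delta by (auto simp: dist_real_def)
    then show "\<exists>d>0. \<forall>x. \<bar>x\<bar> \<le> d \<longrightarrow> \<bar>g x\<bar> \<le> e"
      by (intro exI[of _ "d / 2"]) (auto intro!: less_imp_le)
  qed (use g_le in auto)
  have int_S: "integrable M (\<lambda>\<omega>. iexp (S n \<omega>))" for n
    by (intro integrable_const_bound[of _ 1]) auto
  have main: "(\<lambda>n. C * expectation (\<lambda>\<omega>. iexp (S n \<omega>))) \<longlonglongrightarrow> 1"
  proof (rule LIMSEQ_I)
    fix e :: real assume e: "e > 0"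
    \<comment> \<open>On \<open>A\<close> the compared quantities differ by at most
      \<open>2 * C\<close>, so this level makes their contribution less than
      \<open>e / 2\<close>.\<close>
    obtain K A where K: "K \<ge> 0" "A \<in> events" "prob A < e / (4 * C)"
      "\<And>t \<omega>. \<omega> \<in> space M \<Longrightarrow> moment t \<omega> > ennreal K \<Longrightarrow> \<omega> \<in> A"
      using moment_tail[of "e / (4 * C)"] e C0 by auto
    note [measurable] = K(2)
    \<comment> \<open>The test involves \<open>moment t\<close>, which is
      \<open>F t\<close>-measurable, so the truncated weights stay predictable.\<close>
    define b where "b n t \<omega> = (if moment t \<omega> \<le> ennreal K then a n t \<omega> else 0)" for n t \<omega>
    have b: "b n t \<in> borel_measurable (F t)" if "t < n" for n t
      unfolding b_def using a(1)[OF that] by measurable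
    have b_sq: "(\<Sum>t<n. (b n t \<omega>)\<^sup>2) \<le> T n \<omega>" for n \<omega>
      unfolding T_def by (intro sum_mono) (simp add: b_def)
    define Z where "Z n \<omega> = iexp (\<Sum>t<n. b n t \<omega> * \<epsilon> (Suc t) \<omega>) * exp (\<sigma>\<^sup>2 * (\<Sum>t<n. (b n t \<omega>)\<^sup>2) / 2)" for n \<omega>
    have [measurable]: "Z n \<in> borel_measurable M" for n
    proof -
      have [measurable]: "(\<lambda>\<omega>. \<Sum>t<n. b n t \<omega> * \<epsilon> (Suc t) \<omega>) \<in> borel_measurable M"
        using b by (intro measurable_F[OF weighted_sum_measurable])
      have [measurable]: "(\<lambda>\<omega>. \<Sum>t<n. (b n t \<omega>)\<^sup>2) \<in> borel_measurable M"
        using measurable_F[OF b] by (intro borel_measurable_sum borel_measurable_power) auto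
      show ?thesis unfolding Z_def by measurable
    qed
    have Z_le: "cmod (Z n \<omega>) \<le> C" if "\<omega> \<in> space M" for n \<omega>
      using order_trans[OF b_sq a(3)[OF that, of n, folded T_def]]
      by (simp add: Z_def norm_mult C_def mult_left_mono)
    have int_Z: "integrable M (Z n)" for n
      using Z_le by (intro integrable_const_bound[of _ C]) auto
    have Z_char: "cmod (expectation (Z n) - 1) \<le> C * L * expectation (\<lambda>\<omega>. rate K (r n \<omega>))" for n
      unfolding Z_def C_def
    proof (rule weighted_sum_char_bound[OF b _ _ r(1) _ _ K(1)])
      fix t \<omega> assume t: "t < n" and \<omega>: "\<omega> \<in> space M"
      show "\<bar>b n t \<omega>\<bar> \<le> r n \<omega>" using a(2)[OF t \<omega>] r(2)[OF \<omega>] by (simp add: b_def)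
      show "ennreal K < moment t \<omega> \<Longrightarrow> b n t \<omega> = 0" by (simp add: b_def)
    qed (use order_trans[OF b_sq a(3)[folded T_def]] r in auto)
    have rate_lim: "(\<lambda>n. expectation (\<lambda>\<omega>. \<bar>rate K \<bar>r n \<omega>\<bar>\<bar>)) \<longlonglongrightarrow> 0"
      by (rule expectation_tendsto_zero_in_prob[where B = "rate K B", OF r(1) _ r_lim rate_small[OF K(1)]])
        (use r rate_mono[OF K(1)] rate_nonneg[OF K(1)] in auto)
    moreover have "expectation (\<lambda>\<omega>. \<bar>rate K \<bar>r n \<omega>\<bar>\<bar>) = expectation (\<lambda>\<omega>. rate K (r n \<omega>))" for n
      using r(2) rate_nonneg[OF K(1)] by (intro Bochner_Integration.integral_cong) auto
    ultimately have rate_lim: "(\<lambda>n. expectation (\<lambda>\<omega>. rate K (r n \<omega>))) \<longlonglongrightarrow> 0" by simp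
    have diff: "cmod (C * iexp (S n \<omega>) - Z n \<omega>) \<le> \<bar>g (T n \<omega> - L)\<bar> + 2 * C * indicator A \<omega>" if \<omega>: "\<omega> \<in> space M" for n \<omega>
    proof (cases "\<omega> \<in> A")
      case True
      have "cmod (C * iexp (S n \<omega>) - Z n \<omega>) \<le> cmod (C * iexp (S n \<omega>)) + cmod (Z n \<omega>)"
        by (rule norm_triangle_ineq4)
      also have "\<dots> \<le> C + C" using Z_le[OF \<omega>] C0 by (intro add_mono) (auto simp: norm_mult)
      finally show ?thesis using True by simp
    next
      case False
      then have "b n t \<omega> = a n t \<omega>" for t using K(4)[OF \<omega>] by (auto simp: b_def not_le)
      then have "C * iexp (S n \<omega>) - Z n \<omega> = - iexp (S n \<omega>) * (complex_of_real (exp (\<sigma>\<^sup>2 * T n \<omega> / 2) - C))"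
        by (simp add: Z_def S_def T_def algebra_simps)
      then show ?thesis using False by (simp add: g_eq[OF \<omega>, symmetric] norm_mult del: of_real_diff)
    qed
    have "cmod (C * expectation (\<lambda>\<omega>. iexp (S n \<omega>)) - 1)
        \<le> expectation (\<lambda>\<omega>. \<bar>g (T n \<omega> - L)\<bar>) + C * L * expectation (\<lambda>\<omega>. rate K (r n \<omega>)) + 2 * C * prob A" for n
    proof -
      have int_g: "integrable M (\<lambda>\<omega>. \<bar>g (T n \<omega> - L)\<bar>)"
        using g_le by (intro integrable_const_bound[of _ C]) auto
      have int_A: "integrable M (\<lambda>\<omega>. 2 * C * indicator A \<omega>)"
        by (intro integrable_mult_right integrable_real_indicator) (auto simp: emeasure_eq_measure)
      have "C * expectation (\<lambda>\<omega>. iexp (S n \<omega>)) - 1 =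
          expectation (\<lambda>\<omega>. C * iexp (S n \<omega>) - Z n \<omega>) + (expectation (Z n) - 1)"
        using int_S int_Z by simp
      also have "cmod \<dots> \<le> cmod (expectation (\<lambda>\<omega>. C * iexp (S n \<omega>) - Z n \<omega>)) + cmod (expectation (Z n) - 1)"
        by (rule norm_triangle_ineq)
      also have "cmod (expectation (\<lambda>\<omega>. C * iexp (S n \<omega>) - Z n \<omega>))
          \<le> expectation (\<lambda>\<omega>. cmod (C * iexp (S n \<omega>) - Z n \<omega>))"
        by (rule integral_norm_bound)
      also have "\<dots> \<le> expectation (\<lambda>\<omega>. \<bar>g (T n \<omega> - L)\<bar> + 2 * C * indicator A \<omega>)"
        using diff int_S int_Z int_g int_A
        by (intro integral_mono integrable_norm Bochner_Integration.integrable_diff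
            Bochner_Integration.integrable_add integrable_mult_right) auto
      also have "\<dots> = expectation (\<lambda>\<omega>. \<bar>g (T n \<omega> - L)\<bar>) + 2 * C * prob A"
        using int_g int_A by (subst Bochner_Integration.integral_add) auto
      finally show ?thesis using Z_char[of n] by linarith
    qed
    moreover have "2 * C * prob A < e / 2" using K(3) C0 by (simp add: field_simps)
    moreover have "\<forall>\<^sub>F n in sequentially.
        expectation (\<lambda>\<omega>. \<bar>g (T n \<omega> - L)\<bar>) + C * L * expectation (\<lambda>\<omega>. rate K (r n \<omega>)) < e / 2"
    proof (rule order_tendstoD(2))
      show "(\<lambda>n. expectation (\<lambda>\<omega>. \<bar>g (T n \<omega> - L)\<bar>) + C * L * expectation (\<lambda>\<omega>. rate K (r n \<omega>)))
          \<longlonglongrightarrow> 0 + C * L * 0"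
        by (intro tendsto_intros g_lim rate_lim)
    qed (use e in simp)
    ultimately have "\<forall>\<^sub>F n in sequentially. cmod (C * expectation (\<lambda>\<omega>. iexp (S n \<omega>)) - 1) < e"
      by (elim eventually_mono) (smt (verit) field_sum_of_halves)
    then show "\<exists>n0. \<forall>n\<ge>n0. cmod (C * expectation (\<lambda>\<omega>. iexp (S n \<omega>)) - 1) < e"
      unfolding eventually_sequentially .
  qed
  have "(\<lambda>n. complex_of_real (inverse C) * (C * expectation (\<lambda>\<omega>. iexp (S n \<omega>)))) \<longlonglongrightarrow> complex_of_real (inverse C) * 1"
    by (intro tendsto_intros main)
  moreover have "complex_of_real (inverse C) * (C * z) = z" for z :: complex
    using C0 by simp
  moreover have "inverse C = exp (- (\<sigma>\<^sup>2 * L) / 2)"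
    by (simp add: C_def exp_minus)
  ultimately show ?thesis
    by (simp only: S_def mult_1_right)
qed

end


section \<open>The limit theorem\<close>

text \<open>Domination is phrased by a modulus of continuity, uniform in \<open>n\<close>, so that
  it covers the square root in the bound on the weights as well as linear bounds.\<close>

lemma (in prob_space) tendsto_zero_in_prob_dominated:
  assumes X: "tendsto_zero_in_prob M X" and [measurable]: "\<And>n. X n \<in> borel_measurable M"
    and le: "\<And>e. e > 0 \<Longrightarrow> \<exists>d>0. \<forall>n. \<forall>\<omega>\<in>space M. \<bar>X n \<omega>\<bar> \<le> d \<longrightarrow> \<bar>Y n \<omega>\<bar> \<le> e"
  shows "tendsto_zero_in_prob M Y"
  unfolding tendsto_zero_in_prob_def
proof (intro allI impI)
  fix e :: real assume "e > 0"
  then obtain d where d: "d > 0" "\<And>n \<omega>. \<omega> \<in> space M \<Longrightarrow> \<bar>X n \<omega>\<bar> \<le> d \<Longrightarrow> \<bar>Y n \<omega>\<bar> \<le> e"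
    using le by meson
  have le': "prob {\<omega> \<in> space M. \<bar>Y n \<omega>\<bar> > e} \<le> prob {\<omega> \<in> space M. \<bar>X n \<omega>\<bar> > d}" for n
  proof (rule finite_measure_mono)
    show "{\<omega> \<in> space M. \<bar>Y n \<omega>\<bar> > e} \<subseteq> {\<omega> \<in> space M. \<bar>X n \<omega>\<bar> > d}"
    proof safe
      fix \<omega> assume "\<omega> \<in> space M" "\<bar>Y n \<omega>\<bar> > e"
      then show "\<bar>X n \<omega>\<bar> > d" using d(2)[of \<omega> n] by linarith
    qed
  qed measurable
  have lim: "(\<lambda>n. prob {\<omega> \<in> space M. \<bar>X n \<omega>\<bar> > d}) \<longlonglongrightarrow> 0"
    using X d(1) unfolding tendsto_zero_in_prob_def by blast
  show "(\<lambda>n. prob {\<omega> \<in> space M. \<bar>Y n \<omega>\<bar> > e}) \<longlonglongrightarrow> 0"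
    by (rule tendsto_sandwich[OF _ _ tendsto_const lim]) (simp_all add: le')
qed

lemma op_norm_matrix_inv_le_1:
  assumes "loewner_ge A (mat 1)"
  shows "op_norm (matrix_inv A) \<le> 1"
  unfolding op_norm_def using norm_matrix_inv_mult_le[OF assms] by (intro onorm_bound) auto

locale alee_weights = adaptive_noise M F \<epsilon> \<sigma> \<delta>
  for M :: "'a measure" and F \<epsilon> \<sigma> \<delta> +
  fixes x :: "nat \<Rightarrow> 'a \<Rightarrow> real ^ 'd" and S :: "nat \<Rightarrow> 'a \<Rightarrow> real ^ 'd ^ 'd"
  assumes x: "\<And>t. x (Suc t) \<in> borel_measurable (F t)"
    and norm_x: "\<And>t \<omega>. \<omega> \<in> space M \<Longrightarrow> norm (x (Suc t) \<omega>) \<le> 1"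
    and S: "\<And>n. S n \<in> borel_measurable (F 0)" "\<And>n \<omega>. \<omega> \<in> space M \<Longrightarrow> loewner_ge (S n \<omega>) (mat 1)"
    and stable: "tendsto_zero_in_prob M
      (\<lambda>n \<omega>. op_norm (matrix_inv (S n \<omega>)) + op_norm (alee_V (S n \<omega>) (\<lambda>t. x t \<omega>) n))"
begin

text \<open>Index \<open>t\<close> carries the weight of time \<open>Suc t\<close>, matching the
  shift in \<open>adaptive_noise\<close>; \<open>n\<close> enters through the initial
  matrix.\<close>

definition w :: "nat \<Rightarrow> nat \<Rightarrow> 'a \<Rightarrow> real ^ 'd" where
  "w n t \<omega> = alee_w (S n \<omega>) (\<lambda>t. x t \<omega>) (Suc t)"

lemma x_measurable: "1 \<le> i \<Longrightarrow> i \<le> Suc t \<Longrightarrow> x i \<in> borel_measurable (F t)"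
  using measurable_from_subalg[OF F_mono x, of "i - 1" t] by (cases i) auto

lemma S_measurable: "S n \<in> borel_measurable (F t)"
  by (rule measurable_from_subalg[OF F_mono S(1)]) simp

lemma w_measurable: "w n t \<in> borel_measurable (F t)"
  unfolding w_def
  by (rule borel_measurable_alee_w[where t = "Suc t"]) (auto intro: S_measurable S(2) x_measurable simp: space_F)

lemma stable_measurable:
  "(\<lambda>\<omega>. op_norm (matrix_inv (S n \<omega>)) + op_norm (alee_V (S n \<omega>) (\<lambda>t. x t \<omega>) n)) \<in> borel_measurable M"
  "(\<lambda>\<omega>. op_norm (matrix_inv (S n \<omega>))) \<in> borel_measurable M"
proof -
  have S': "S n \<in> borel_measurable M" using measurable_F[OF S(1)] .
  have x': "x i \<in> borel_measurable M" if "1 \<le> i" for i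
    using that measurable_F[OF x[of "i - 1"]] by (cases i) auto
  show 1: "(\<lambda>\<omega>. op_norm (matrix_inv (S n \<omega>))) \<in> borel_measurable M"
    by (intro borel_measurable_continuous_on[OF continuous_on_op_norm] borel_measurable_matrix_inv S' S(2))
  have "(\<lambda>\<omega>. op_norm (alee_V (S n \<omega>) (\<lambda>t. x t \<omega>) n)) \<in> borel_measurable M"
    by (intro borel_measurable_continuous_on[OF continuous_on_op_norm] borel_measurable_alee_V[where t = n] S' S(2) x') auto
  with 1 show "(\<lambda>\<omega>. op_norm (matrix_inv (S n \<omega>)) + op_norm (alee_V (S n \<omega>) (\<lambda>t. x t \<omega>) n)) \<in> borel_measurable M"
    by measurable
qed

lemma w_le:
  assumes "\<omega> \<in> space M"
  shows "\<bar>u \<bullet> w n t \<omega>\<bar> \<le> norm u * sqrt (op_norm (matrix_inv (S n \<omega>)))"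
  unfolding w_def using assms by (intro inner_alee_w_le S(2) norm_x) auto

lemma w_bound_le:
  assumes "\<omega> \<in> space M"
  shows "norm u * sqrt (op_norm (matrix_inv (S n \<omega>))) \<le> norm u"
  using op_norm_matrix_inv_le_1[OF S(2)[OF assms, of n]] by (simp add: mult_left_le)

lemma sum_w_sq_le:
  assumes "\<omega> \<in> space M"
  shows "(\<Sum>t<n. (u \<bullet> w n t \<omega>)\<^sup>2) \<le> (norm u)\<^sup>2"
  using sum_inner_alee_w_sq_le[OF S(2)[OF assms, of n], of u "\<lambda>t. x t \<omega>" n]
  by (simp add: w_def sum.atLeast1_atMost_eq)

lemma sum_w_sq_diff:
  assumes "\<omega> \<in> space M"
  shows "\<bar>(\<Sum>t<n. (u \<bullet> w n t \<omega>)\<^sup>2) - (norm u)\<^sup>2\<bar> \<le> (norm u)\<^sup>2 * op_norm (alee_V (S n \<omega>) (\<lambda>t. x t \<omega>) n)"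
  using sum_inner_alee_w_sq_diff[OF S(2)[OF assms, of n], of u "\<lambda>t. x t \<omega>" n]
  by (simp add: w_def sum.atLeast1_atMost_eq)

definition noise :: "nat \<Rightarrow> 'a \<Rightarrow> real ^ 'd" where
  "noise n \<omega> = (\<Sum>t<n. \<epsilon> (Suc t) \<omega> *\<^sub>R w n t \<omega>)"

lemma inner_noise: "u \<bullet> noise n \<omega> = (\<Sum>t<n. (u \<bullet> w n t \<omega>) * \<epsilon> (Suc t) \<omega>)"
  by (simp add: noise_def inner_sum_right mult.commute)

lemma noise_measurable [measurable]: "noise n \<in> borel_measurable M"
  unfolding noise_def using measurable_F[OF w_measurable] by measurable

lemma inner_w_measurable: "(\<lambda>\<omega>. u \<bullet> w n t \<omega>) \<in> borel_measurable (F t)"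
  using w_measurable by measurable

lemma noise_char:
  "(\<lambda>n. expectation (\<lambda>\<omega>. iexp (u \<bullet> noise n \<omega>))) \<longlonglongrightarrow> exp (- (\<sigma>\<^sup>2 * (norm u)\<^sup>2) / 2)"
  unfolding inner_noise
proof (rule weighted_sum_char_tendsto[where r = "\<lambda>n \<omega>. norm u * sqrt (op_norm (matrix_inv (S n \<omega>)))" and B = "norm u"])
  show "(\<lambda>\<omega>. norm u * sqrt (op_norm (matrix_inv (S n \<omega>)))) \<in> borel_measurable M" for n
    using stable_measurable(2) by measurable
  show "tendsto_zero_in_prob M (\<lambda>n \<omega>. norm u * sqrt (op_norm (matrix_inv (S n \<omega>))))"
  proof (rule tendsto_zero_in_prob_dominated[OF stable stable_measurable(1)])
    fix e :: real assume e: "e > 0"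
    \<comment> \<open>Squared to undo the square root; the added 1 keeps the quotient meaningful for
      \<open>u = 0\<close>.\<close>
    let ?d = "(e / (norm u + 1))\<^sup>2"
    have nu: "norm u + 1 > 0" by (simp add: add_nonneg_pos)
    show "\<exists>d>0. \<forall>n. \<forall>\<omega>\<in>space M. \<bar>op_norm (matrix_inv (S n \<omega>)) +
        op_norm (alee_V (S n \<omega>) (\<lambda>t. x t \<omega>) n)\<bar> \<le> d \<longrightarrow> \<bar>norm u * sqrt (op_norm (matrix_inv (S n \<omega>)))\<bar> \<le> e"
    proof (intro exI[of _ ?d] conjI allI ballI impI)
      show "?d > 0" using e nu by simp
      fix n \<omega> assume \<omega>: "\<omega> \<in> space M"
      assume "\<bar>op_norm (matrix_inv (S n \<omega>)) + op_norm (alee_V (S n \<omega>) (\<lambda>t. x t \<omega>) n)\<bar> \<le> ?d"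
      then have "op_norm (matrix_inv (S n \<omega>)) \<le> ?d"
        using op_norm_nonneg[of "alee_V (S n \<omega>) (\<lambda>t. x t \<omega>) n"] by linarith
      then have "sqrt (op_norm (matrix_inv (S n \<omega>))) \<le> e / (norm u + 1)"
        using e nu by (intro real_le_lsqrt) auto
      then have "norm u * sqrt (op_norm (matrix_inv (S n \<omega>))) \<le> norm u * (e / (norm u + 1))"
        by (intro mult_left_mono) auto
      also have "\<dots> \<le> e" using e nu by (simp add: field_simps)
      finally show "\<bar>norm u * sqrt (op_norm (matrix_inv (S n \<omega>)))\<bar> \<le> e"
        by (simp add: op_norm_nonneg)
    qed
  qed
  show "tendsto_zero_in_prob M (\<lambda>n \<omega>. (\<Sum>t<n. (u \<bullet> w n t \<omega>)\<^sup>2) - (norm u)\<^sup>2)"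
  proof (rule tendsto_zero_in_prob_dominated[OF stable stable_measurable(1)])
    fix e :: real assume e: "e > 0"
    let ?d = "e / ((norm u)\<^sup>2 + 1)"
    have nu: "(norm u)\<^sup>2 + 1 > 0" by (simp add: add_nonneg_pos)
    show "\<exists>d>0. \<forall>n. \<forall>\<omega>\<in>space M. \<bar>op_norm (matrix_inv (S n \<omega>)) +
        op_norm (alee_V (S n \<omega>) (\<lambda>t. x t \<omega>) n)\<bar> \<le> d \<longrightarrow> \<bar>(\<Sum>t<n. (u \<bullet> w n t \<omega>)\<^sup>2) - (norm u)\<^sup>2\<bar> \<le> e"
    proof (intro exI[of _ ?d] conjI allI ballI impI)
      show "?d > 0" using e nu by simp
      fix n \<omega> assume \<omega>: "\<omega> \<in> space M"
      assume "\<bar>op_norm (matrix_inv (S n \<omega>)) + op_norm (alee_V (S n \<omega>) (\<lambda>t. x t \<omega>) n)\<bar> \<le> ?d"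
      then have "op_norm (alee_V (S n \<omega>) (\<lambda>t. x t \<omega>) n) \<le> ?d"
        using op_norm_nonneg[of "matrix_inv (S n \<omega>)"] by linarith
      then have "(norm u)\<^sup>2 * op_norm (alee_V (S n \<omega>) (\<lambda>t. x t \<omega>) n) \<le> (norm u)\<^sup>2 * ?d"
        by (intro mult_left_mono) auto
      also have "\<dots> \<le> e" using e nu by (simp add: field_simps)
      finally show "\<bar>(\<Sum>t<n. (u \<bullet> w n t \<omega>)\<^sup>2) - (norm u)\<^sup>2\<bar> \<le> e"
        using sum_w_sq_diff[OF \<omega>, of u n] by linarith
    qed
  qed
qed (use inner_w_measurable w_le w_bound_le sum_w_sq_le in \<open>auto simp: op_norm_nonneg\<close>)

text \<open>In each basis direction the squared weights sum to at most 1, so each of the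
  \<open>CARD('d)\<close> coordinates has second moment at most \<open>\<sigma>^2\<close>, uniformly
  in \<open>n\<close>.\<close>

lemma noise_second_moment:
  "integrable M (\<lambda>\<omega>. (norm (noise n \<omega>))\<^sup>2)" "expectation (\<lambda>\<omega>. (norm (noise n \<omega>))\<^sup>2) \<le> \<sigma>\<^sup>2 * CARD('d)"
proof -
  have eq: "(norm (noise n \<omega>))\<^sup>2 = (\<Sum>b\<in>Basis. (b \<bullet> noise n \<omega>)\<^sup>2)" for \<omega>
    unfolding power2_norm_eq_inner by (subst euclidean_inner) (simp add: power2_eq_square inner_commute)
  have le: "\<bar>u \<bullet> w n t \<omega>\<bar> \<le> norm u" if "\<omega> \<in> space M" for u t \<omega>
    using w_le[OF that, of u n t] w_bound_le[OF that, of u n] by linarith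
  note sm = weighted_sum_second_moment[of n "\<lambda>t \<omega>. b \<bullet> w n t \<omega>" "norm b" for b, OF inner_w_measurable le, folded inner_noise]
  have int: "integrable M (\<lambda>\<omega>. (b \<bullet> noise n \<omega>)\<^sup>2)" for b using sm(1) by blast
  show "integrable M (\<lambda>\<omega>. (norm (noise n \<omega>))\<^sup>2)"
    unfolding eq using int by simp
  have "expectation (\<lambda>\<omega>. (b \<bullet> noise n \<omega>)\<^sup>2) \<le> \<sigma>\<^sup>2" if "b \<in> Basis" for b
  proof -
    have "(\<lambda>\<omega>. \<Sum>t<n. (b \<bullet> w n t \<omega>)\<^sup>2) \<in> borel_measurable M"
      using measurable_F[OF inner_w_measurable] by measurable
    then have "integrable M (\<lambda>\<omega>. \<Sum>t<n. (b \<bullet> w n t \<omega>)\<^sup>2)"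
      using sum_w_sq_le[where u = b and n = n] that by (intro integrable_const_bound[of _ 1]) (auto simp: sum_nonneg)
    then have "expectation (\<lambda>\<omega>. \<Sum>t<n. (b \<bullet> w n t \<omega>)\<^sup>2) \<le> expectation (\<lambda>\<omega>. 1)"
      using sum_w_sq_le[where u = b and n = n] that by (intro integral_mono) auto
    then have "\<sigma>\<^sup>2 * expectation (\<lambda>\<omega>. \<Sum>t<n. (b \<bullet> w n t \<omega>)\<^sup>2) \<le> \<sigma>\<^sup>2 * 1"
      by (intro mult_left_mono) (simp_all add: prob_space)
    then show ?thesis using sm(2)[of b] by simp
  qed
  then have "(\<Sum>b\<in>(Basis::(real^'d) set). expectation (\<lambda>\<omega>. (b \<bullet> noise n \<omega>)\<^sup>2)) \<le> (\<Sum>b\<in>(Basis::(real^'d) set). \<sigma>\<^sup>2)"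
    by (rule sum_mono)
  then show "expectation (\<lambda>\<omega>. (norm (noise n \<omega>))\<^sup>2) \<le> \<sigma>\<^sup>2 * CARD('d)"
    unfolding eq using int by (simp add: mult.commute)
qed

lemma noise_tight:
  assumes "e > 0"
  shows "\<exists>R. \<forall>n. prob {\<omega> \<in> space M. norm (noise n \<omega>) > R} \<le> e"
proof (intro exI allI)
  fix n
  \<comment> \<open>Chosen so that the Chebyshev bound \<open>\<sigma>^2 * CARD('d) / R^2\<close>
    equals \<open>e\<close>.\<close>
  define R where "R = sqrt (\<sigma>\<^sup>2 * CARD('d) / e)"
  have R: "R > 0" "R\<^sup>2 = \<sigma>\<^sup>2 * CARD('d) / e" using \<sigma> assms by (auto simp: R_def)
  let ?A = "{\<omega> \<in> space M. norm (noise n \<omega>) > R}"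
  have int: "integrable M (\<lambda>\<omega>. R\<^sup>2 * indicator ?A \<omega>)"
    by (intro integrable_mult_right integrable_real_indicator) (auto simp: emeasure_eq_measure)
  have "R\<^sup>2 * prob ?A = expectation (\<lambda>\<omega>. R\<^sup>2 * indicator ?A \<omega>)" by simp
  also have "\<dots> \<le> expectation (\<lambda>\<omega>. (norm (noise n \<omega>))\<^sup>2)"
    using R(1) by (intro integral_mono int noise_second_moment(1)) (auto simp: indicator_def intro!: power_mono)
  also have "\<dots> \<le> \<sigma>\<^sup>2 * CARD('d)" by (rule noise_second_moment(2))
  finally have "R\<^sup>2 * prob ?A \<le> R\<^sup>2 * e" using assms by (simp add: R(2))
  then show "prob {\<omega> \<in> space M. norm (noise n \<omega>) > R} \<le> e" using R(1) by simp
qed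

text \<open>The estimating equation holds almost surely, so the normalised error is a version of
  \<open>noise n\<close>; characteristic functions and tail probabilities agree.\<close>

theorem converges_to_normal:
  assumes X: "\<And>n. X n \<in> borel_measurable M" "\<And>n. AE \<omega> in M. X n \<omega> = noise n \<omega>"
  shows "converges_in_distribution M X (multivariate_normal 0 (\<sigma>\<^sup>2 *\<^sub>R mat 1))"
  unfolding converges_in_distribution_def
proof (rule weakly_converges_from_char)
  note [measurable] = X(1)
  show "prob_space (distr M borel (X n))" for n by (rule prob_space_distr) measurable
  show "prob_space (multivariate_normal 0 (\<sigma>\<^sup>2 *\<^sub>R mat 1 :: real ^ 'd ^ 'd))"
    by (rule prob_space_multivariate_normal_isotropic[OF \<sigma>])
  have "(\<integral>v. iexp (u \<bullet> v) \<partial>distr M borel (X n)) = expectation (\<lambda>\<omega>. iexp (u \<bullet> noise n \<omega>))" for u n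
  proof -
    have "(\<integral>v. iexp (u \<bullet> v) \<partial>distr M borel (X n)) = expectation (\<lambda>\<omega>. iexp (u \<bullet> X n \<omega>))"
      by (rule integral_distr) measurable
    also have "\<dots> = expectation (\<lambda>\<omega>. iexp (u \<bullet> noise n \<omega>))"
      using X(2)[of n] by (intro integral_cong_AE) auto
    finally show ?thesis .
  qed
  then show "(\<lambda>n. \<integral>v. iexp (u \<bullet> v) \<partial>distr M borel (X n)) \<longlonglongrightarrow>
      (\<integral>v. iexp (u \<bullet> v) \<partial>multivariate_normal 0 (\<sigma>\<^sup>2 *\<^sub>R mat 1))" for u
    using noise_char[of u] by (simp only: char_multivariate_normal_isotropic[OF \<sigma>])
  fix e :: real assume "e > 0"
  then obtain R where R: "\<And>n. prob {\<omega> \<in> space M. norm (noise n \<omega>) > R} \<le> e"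
    using noise_tight by blast
  have "measure (distr M borel (X n)) {v. norm v > R} = prob {\<omega> \<in> space M. norm (noise n \<omega>) > R}" for n
  proof -
    have "measure (distr M borel (X n)) {v. norm v > R} = prob (X n -` {v. norm v > R} \<inter> space M)"
      by (rule measure_distr) auto
    also have "\<dots> = prob {\<omega> \<in> space M. norm (noise n \<omega>) > R}"
      using X(2)[of n] by (intro measure_eq_AE) auto
    finally show ?thesis .
  qed
  then show "\<exists>R. \<forall>n. measure (distr M borel (X n)) {v. norm v > R} \<le> e"
    using R by (intro exI[of _ R]) simp
qed (simp_all add: sets_multivariate_normal)

end

theorem theorem3p6:
  fixes M :: "'a measure"
    and F :: "nat \<Rightarrow> 'a measure"
    and x :: "nat \<Rightarrow> 'a \<Rightarrow> real ^ 'd"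
    and y \<epsilon> :: "nat \<Rightarrow> 'a \<Rightarrow> real"
    and \<theta> :: "real ^ 'd"
    and \<sigma> \<delta> :: real
    and \<Sigma>0 :: "nat \<Rightarrow> 'a \<Rightarrow> real ^ 'd ^ 'd"
    and \<theta>_hat :: "nat \<Rightarrow> 'a \<Rightarrow> real ^ 'd"
  assumes "prob_space M"
    and "filtration (space M) F"
    and "\<And>t. subalgebra M (F t)"
    and "\<And>t. t \<ge> 1 \<Longrightarrow> x t \<in> borel_measurable (F (t - 1))"
    and "\<And>t. t \<ge> 1 \<Longrightarrow> y t \<in> borel_measurable (F t)"
    and "\<And>t \<omega>. t \<ge> 1 \<Longrightarrow> \<omega> \<in> space M \<Longrightarrow> y t \<omega> = x t \<omega> \<bullet> \<theta> + \<epsilon> t \<omega>"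
    and "\<And>t \<omega>. t \<ge> 1 \<Longrightarrow> \<omega> \<in> space M \<Longrightarrow> norm (x t \<omega>) \<le> 1"
    and "\<sigma> > 0"
    and "\<delta> > 0"
    and "\<And>t. t \<ge> 1 \<Longrightarrow> AE \<omega> in M. real_cond_exp M (F (t - 1)) (\<epsilon> t) \<omega> = 0"
    and "\<And>t. t \<ge> 1 \<Longrightarrow>
           AE \<omega> in M. nn_cond_exp M (F (t - 1)) (\<lambda>\<omega>. ennreal ((\<epsilon> t \<omega>)\<^sup>2)) \<omega> = ennreal (\<sigma>\<^sup>2)"
    and "AE \<omega> in M. (SUP t\<in>{1..}. nn_cond_exp M (F (t - 1))
           (\<lambda>\<omega>. ennreal (\<bar>\<epsilon> t \<omega> / \<sigma>\<bar> powr (2 + \<delta>))) \<omega>) < \<infinity>"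
    and "\<And>n. \<Sigma>0 n \<in> borel_measurable (F 0)"
    and "\<And>n \<omega>. \<omega> \<in> space M \<Longrightarrow> loewner_ge (\<Sigma>0 n \<omega>) (mat 1)"
    and "tendsto_zero_in_prob M
           (\<lambda>n \<omega>. op_norm (matrix_inv (\<Sigma>0 n \<omega>)) + op_norm (alee_V (\<Sigma>0 n \<omega>) (\<lambda>t. x t \<omega>) n))"
    and "\<And>n. \<theta>_hat n \<in> borel_measurable M"
    and "\<And>n. AE \<omega> in M.
           (\<Sum>t=1..n. (y t \<omega> - x t \<omega> \<bullet> \<theta>_hat n \<omega>) *\<^sub>R alee_w (\<Sigma>0 n \<omega>) (\<lambda>t. x t \<omega>) t) = 0"
  shows "converges_in_distribution M
           (\<lambda>n \<omega>. (\<Sum>t=1..n. outer_prod (alee_w (\<Sigma>0 n \<omega>) (\<lambda>t. x t \<omega>) t) (x t \<omega>))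
                     *v (\<theta>_hat n \<omega> - \<theta>))
           (multivariate_normal 0 (\<sigma>\<^sup>2 *\<^sub>R mat 1))"
proof -
  interpret prob_space M by fact
  interpret filtration "space M" F by fact
  have sp: "space (F t) = space M" for t using assms(3)[of t] by (simp add: subalgebra_def)
  have mono: "subalgebra (F t) (F s)" if "s \<le> t" for s t
    using sets_F_mono[OF that] by (simp add: subalgebra_def sp)
  have x: "x (Suc t) \<in> borel_measurable (F t)" for t using assms(4)[of "Suc t"] by simp
  \<comment> \<open>Adaptedness of the noise is recovered from the model as
    \<open>y - x \<bullet> \<theta>\<close>, an identity valid on the sample space.\<close>
  have eps: "\<epsilon> (Suc t) \<in> borel_measurable (F (Suc t))" for t
  proof -
    have "x (Suc t) \<in> borel_measurable (F (Suc t))"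
      by (rule measurable_from_subalg[OF mono x]) simp
    then have "(\<lambda>\<omega>. y (Suc t) \<omega> - x (Suc t) \<omega> \<bullet> \<theta>) \<in> borel_measurable (F (Suc t))"
      using assms(5)[of "Suc t"] by measurable
    moreover have "\<epsilon> (Suc t) \<omega> = y (Suc t) \<omega> - x (Suc t) \<omega> \<bullet> \<theta>" if "\<omega> \<in> space (F (Suc t))" for \<omega>
      using assms(6)[of "Suc t" \<omega>] that by (simp add: sp)
    ultimately show ?thesis by (simp cong: measurable_cong)
  qed
  have range: "{1..} = range Suc" by (auto simp: image_iff) (metis Suc_le_D One_nat_def)
  interpret alee_weights M F \<epsilon> \<sigma> \<delta> x \<Sigma>0
  proof
    show "subalgebra M (F t)" for t by (rule assms(3))
    show "subalgebra (F t) (F s)" if "s \<le> t" for s t using that by (rule mono)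
    show "\<epsilon> (Suc t) \<in> borel_measurable (F (Suc t))" for t by (rule eps)
    show "AE \<omega> in M. real_cond_exp M (F t) (\<epsilon> (Suc t)) \<omega> = 0" for t
      using assms(10)[of "Suc t"] by simp
    show "AE \<omega> in M. nn_cond_exp M (F t) (\<lambda>\<omega>. ennreal ((\<epsilon> (Suc t) \<omega>)\<^sup>2)) \<omega> = ennreal (\<sigma>\<^sup>2)" for t
      using assms(11)[of "Suc t"] by simp
    show "AE \<omega> in M. (SUP t. nn_cond_exp M (F t) (\<lambda>\<omega>. ennreal (\<bar>\<epsilon> (Suc t) \<omega> / \<sigma>\<bar> powr (2 + \<delta>))) \<omega>) < \<infinity>"
      using assms(12) unfolding range by (simp add: image_image)
  qed (use assms x in auto)
  have w_meas: "(\<lambda>\<omega>. alee_w (\<Sigma>0 n \<omega>) (\<lambda>t. x t \<omega>) (Suc t)) \<in> borel_measurable M" for n t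
    using measurable_F[OF w_measurable[of n t]] unfolding w_def .
  have x_meas: "x (Suc t) \<in> borel_measurable M" for t using measurable_F[OF x] .
  show ?thesis
  proof (rule converges_to_normal)
    fix n
    show "(\<lambda>\<omega>. (\<Sum>t=1..n. outer_prod (alee_w (\<Sigma>0 n \<omega>) (\<lambda>t. x t \<omega>) t) (x t \<omega>)) *v (\<theta>_hat n \<omega> - \<theta>))
        \<in> borel_measurable M"
      using assms(16)[of n] w_meas[of n] x_meas unfolding One_nat_def sum.atLeast1_atMost_eq by measurable
    have "(\<Sum>t=1..n. outer_prod (alee_w (\<Sigma>0 n \<omega>) (\<lambda>t. x t \<omega>) t) (x t \<omega>)) *v (\<theta>_hat n \<omega> - \<theta>) = noise n \<omega>"
      if \<omega>: "\<omega> \<in> space M"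
        and 0: "(\<Sum>t=1..n. (y t \<omega> - x t \<omega> \<bullet> \<theta>_hat n \<omega>) *\<^sub>R alee_w (\<Sigma>0 n \<omega>) (\<lambda>t. x t \<omega>) t) = 0" for \<omega>
    proof -
      \<comment> \<open>Splits the projected estimation error into noise minus residual; summed
        against the weights, the residuals cancel by the estimating equation.\<close>
      have res: "x (Suc t) \<omega> \<bullet> (\<theta>_hat n \<omega> - \<theta>) =
          \<epsilon> (Suc t) \<omega> - (y (Suc t) \<omega> - x (Suc t) \<omega> \<bullet> \<theta>_hat n \<omega>)" for t
        using assms(6)[of "Suc t" \<omega>] \<omega> by (simp add: inner_diff_right)
      have "(\<Sum>t=1..n. outer_prod (alee_w (\<Sigma>0 n \<omega>) (\<lambda>t. x t \<omega>) t) (x t \<omega>)) *v (\<theta>_hat n \<omega> - \<theta>) =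
          (\<Sum>t<n. (x (Suc t) \<omega> \<bullet> (\<theta>_hat n \<omega> - \<theta>)) *\<^sub>R w n t \<omega>)"
        by (simp add: sum_matrix_vector_mult outer_prod_mult w_def sum.atLeast1_atMost_eq)
      also have "\<dots> = noise n \<omega> - (\<Sum>t<n. (y (Suc t) \<omega> - x (Suc t) \<omega> \<bullet> \<theta>_hat n \<omega>) *\<^sub>R w n t \<omega>)"
        unfolding res by (simp only: noise_def scaleR_diff_left sum_subtractf)
      also have "(\<Sum>t<n. (y (Suc t) \<omega> - x (Suc t) \<omega> \<bullet> \<theta>_hat n \<omega>) *\<^sub>R w n t \<omega>) = 0"
        using 0 by (simp add: w_def sum.atLeast1_atMost_eq)
      finally show ?thesis by simp
    qed
    then show "AE \<omega> in M. (\<Sum>t=1..n. outer_prod (alee_w (\<Sigma>0 n \<omega>) (\<lambda>t. x t \<omega>) t) (x t \<omega>)) *v (\<theta>_hat n \<omega> - \<theta>)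
        = noise n \<omega>"
      using assms(17)[of n] by auto
  qed
qed

end
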